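(* The worst-case approximation ratio of the grammar-based compressor RePair on words over a binary alphabet satisfies $$\alpha_{\mathrm{RePair}}(2,n)\in\Omega\left(\frac{\log n}{\log\log n}\right).$$
   Context: A straight-line program (SLP) over a finite alphabet $\Sigma$ is a context-free grammar $\mathbb{A}=(N,\Sigma,P,S)$ with a finite set $N$ of nonterminals ($N\cap\Sigma=\emptyset$), start nonterminal $S\in N$, and a finite set $P$ of productions $A\to w$ with $A\in N$, $w\in(N\cup\Sigma)^+$, such that (i) for every $A\in N$ there is exactly one production with left-hand side $A$, and (ii) the relation $\{(A,B)\in N\times N \mid (A\to w)\in P,\ B \text{ occurs in } w\}$ is acyclic. Every nonterminal $A$ produces a unique word $\mathrm{val}(A)\in\Sigma^+$, and $\mathrm{val}(\mathbb{A})=\mathrm{val}(S)$. The size of $\mathbb{A}$ is $|\mathbb{A}|=\sum_{(A\to w)\in P}|w|$. For a nonempty word $w$, $g(w)$ denotes the size of a smallest SLP producing $w$. A grammar-based compressor $\mathcal{C}$ computes for each nonempty word $w$ an SLP $\mathcal{C}(w)$ with $\mathrm{val}(\mathcal{C}(w))=w$. With $[1,k]=\{1,\dots,k\}$, its worst-case approximation ratio is $$\alpha_{\mathcal{C}}(k,n)=\max\{|\mathcal{C}(w)|/g(w) \mid w\in[1,k]^n\}.$$ RePair: for an SLP $\mathbb{A}=(N,\Sigma,P,S)$, a word $\gamma\in(N\cup\Sigma)^+$ is a maximal string of $\mathbb{A}$ if $|\gamma|\ge 2$, $\gamma$ appears at least twice without overlap in the right-hand sides of $\mathbb{A}$, and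 no strictly longer word appears at least as many times without overlap in the right-hand sides of $\mathbb{A}$. On input $w$, RePair starts with the trivial SLP with the single rule $S\to w$. In each round it selects a most frequent maximal string $\gamma$ of the current SLP (i.e. one with the largest number of pairwise non-overlapping occurrences in the right-hand sides; ties are broken by an arbitrary fixed rule), replaces a largest set of pairwise non-overlapping occurrences of $\gamma$ in the right-hand sides by a fresh nonterminal $X$ (occurrences are replaced from left to right), and adds the rule $X\to\gamma$. It stops when the current SLP has no maximal string, and outputs the current SLP. *)

theory Defs
  imports Complex_Main "HOL-Library.While_Combinator" "HOL-Library.Landau_Symbols"
    "HOL-Library.Sublist"
begin

datatype ('n, 't) sym = Nt 'n | Tm 't

record ('n, 't) grammar =
  nonterms :: "'n set"
  alphabet :: "'t set"
  prods :: "('n \<times> ('n, 't) sym list) set"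
  start :: 'n

definition slp :: "('n, 't) grammar \<Rightarrow> bool" where
  "slp G \<longleftrightarrow>
     finite (nonterms G) \<and> finite (alphabet G) \<and> finite (prods G) \<and> start G \<in> nonterms G \<and>
     (\<forall>(A, w) \<in> prods G. A \<in> nonterms G \<and> w \<noteq> [] \<and> set w \<subseteq> Nt ` nonterms G \<union> Tm ` alphabet G) \<and>
     (\<forall>A \<in> nonterms G. \<exists>!w. (A, w) \<in> prods G) \<and>
     acyclic {(A, B). A \<in> nonterms G \<and> B \<in> nonterms G \<and> (\<exists>w. (A, w) \<in> prods G \<and> Nt B \<in> set w)}"

inductive derive1 :: "('n, 't) grammar \<Rightarrow> ('n, 't) sym list \<Rightarrow> ('n, 't) sym list \<Rightarrow> bool"
  for G where
  "(A, w) \<in> prods G \<Longrightarrow> derive1 G (u @ [Nt A] @ v) (u @ w @ v)"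

text \<open>The description is unique whenever \<open>slp G\<close> and \<open>A \<in> nonterms G\<close>
  (lemma \<open>slp_val_unique\<close> below).\<close>

definition val_nt :: "('n, 't) grammar \<Rightarrow> 'n \<Rightarrow> 't list" where
  "val_nt G A = (THE w. (derive1 G)\<^sup>*\<^sup>* [Nt A] (map Tm w))"

definition val :: "('n, 't) grammar \<Rightarrow> 't list" where
  "val G = val_nt G (start G)"

definition gsize :: "('n, 't) grammar \<Rightarrow> nat" where
  "gsize G = (\<Sum>(A, w) \<in> prods G. length w)"

text \<open>Taking natural numbers as nonterminals loses nothing, since the set of nonterminals of an
  SLP is finite.\<close>

definition smallest_slp_size :: "'t list \<Rightarrow> nat" where
  "smallest_slp_size w = (LEAST m. \<exists>G :: (nat, 't) grammar. slp G \<and> val G = w \<and> gsize G = m)"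

definition approx_ratio :: "(nat list \<Rightarrow> (nat, nat) grammar) \<Rightarrow> nat \<Rightarrow> nat \<Rightarrow> real" where
  "approx_ratio C k n =
     Max {real (gsize (C w)) / real (smallest_slp_size w) | w. set w \<subseteq> {1..k} \<and> length w = n}"

text \<open>An occurrence of \<open>\<gamma>\<close> is a pair \<open>(A, i)\<close>: it starts at position \<open>i\<close> (counted from 0) of the
  right-hand side of \<open>A\<close>. Occurrences in different right-hand sides never overlap.\<close>

definition occurrences :: "('n, 't) grammar \<Rightarrow> ('n, 't) sym list \<Rightarrow> ('n \<times> nat) set" where
  "occurrences G \<gamma> =
     {(A, i). \<exists>w. (A, w) \<in> prods G \<and> i + length \<gamma> \<le> length w \<and> take (length \<gamma>) (drop i w) = \<gamma>}"

definition nonoverlapping :: "nat \<Rightarrow> ('n \<times> nat) set \<Rightarrow> bool" where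
  "nonoverlapping l Q \<longleftrightarrow> (\<forall>A i j. (A, i) \<in> Q \<and> (A, j) \<in> Q \<and> i < j \<longrightarrow> i + l \<le> j)"

definition freq :: "('n, 't) grammar \<Rightarrow> ('n, 't) sym list \<Rightarrow> nat" where
  "freq G \<gamma> = Max {card Q | Q. Q \<subseteq> occurrences G \<gamma> \<and> nonoverlapping (length \<gamma>) Q}"

definition maximal_string :: "('n, 't) grammar \<Rightarrow> ('n, 't) sym list \<Rightarrow> bool" where
  "maximal_string G \<gamma> \<longleftrightarrow>
     length \<gamma> \<ge> 2 \<and> freq G \<gamma> \<ge> 2 \<and> \<not> (\<exists>\<delta>. length \<delta> > length \<gamma> \<and> freq G \<delta> \<ge> freq G \<gamma>)"

definition most_frequent_maximal_string :: "('n, 't) grammar \<Rightarrow> ('n, 't) sym list \<Rightarrow> bool" where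
  "most_frequent_maximal_string G \<gamma> \<longleftrightarrow>
     maximal_string G \<gamma> \<and> (\<forall>\<delta>. maximal_string G \<delta> \<longrightarrow> freq G \<delta> \<le> freq G \<gamma>)"

text \<open>Replacing greedily from left to right replaces a largest set of pairwise non-overlapping
  occurrences. The guard \<open>\<gamma> \<noteq> []\<close> only serves termination.\<close>

function replace_word :: "'a list \<Rightarrow> 'a \<Rightarrow> 'a list \<Rightarrow> 'a list" where
  "replace_word \<gamma> x [] = []"
| "replace_word \<gamma> x (a # w) =
     (if \<gamma> \<noteq> [] \<and> prefix \<gamma> (a # w) then x # replace_word \<gamma> x (drop (length \<gamma>) (a # w))
      else a # replace_word \<gamma> x w)"
  by pat_completeness auto
termination
  by (relation "measure (\<lambda>(\<gamma>, x, w). length w)") (auto simp: less_Suc_eq_le neq_Nil_conv)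

definition fresh :: "(nat, 't) grammar \<Rightarrow> nat" where
  "fresh G = (LEAST X. X \<notin> nonterms G)"

definition replace_string :: "(nat, 't) sym list \<Rightarrow> (nat, 't) grammar \<Rightarrow> (nat, 't) grammar" where
  "replace_string \<gamma> G =
     G\<lparr>nonterms := insert (fresh G) (nonterms G),
       prods := insert (fresh G, \<gamma>)
         ((\<lambda>(A, w). (A, replace_word \<gamma> (Nt (fresh G)) w)) ` prods G)\<rparr>"

definition trivial_slp :: "'t list \<Rightarrow> (nat, 't) grammar" where
  "trivial_slp w = \<lparr>nonterms = {0}, alphabet = set w, prods = {(0, map Tm w)}, start = 0\<rparr>"

text \<open>A fixed tie-breaking rule amounts to a function that selects, for each SLP that has a maximal
  string, one of its most frequent maximal strings.\<close>

definition selection_rule :: "((nat, 't) grammar \<Rightarrow> (nat, 't) sym list) \<Rightarrow> bool" where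
  "selection_rule sel \<longleftrightarrow>
     (\<forall>G. slp G \<and> (\<exists>\<gamma>. maximal_string G \<gamma>) \<longrightarrow> most_frequent_maximal_string G (sel G))"

definition RePair ::
  "((nat, 't) grammar \<Rightarrow> (nat, 't) sym list) \<Rightarrow> 't list \<Rightarrow> (nat, 't) grammar" where
  "RePair sel w =
     while (\<lambda>G. \<exists>\<gamma>. maximal_string G \<gamma>) (\<lambda>G. replace_string (sel G) G) (trivial_slp w)"


section \<open>Well-definedness\<close>

text \<open>Uniqueness of the produced word (\<open>slp_val_unique\<close>), existence of selection rules
  (\<open>ex_selection_rule\<close>), termination and correctness of RePair (\<open>RePair_correct\<close>).\<close>

definition ext :: "('n \<Rightarrow> 't list) \<Rightarrow> ('n, 't) sym list \<Rightarrow> 't list" where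
  "ext f u = concat (map (\<lambda>s. case s of Nt A \<Rightarrow> f A | Tm a \<Rightarrow> [a]) u)"

lemma ext_simps [simp]:
  "ext f [] = []" "ext f (Nt A # u) = f A @ ext f u" "ext f (Tm a # u) = a # ext f u"
  "ext f (u @ v) = ext f u @ ext f v"
  by (simp_all add: ext_def)

lemma ext_map_Tm [simp]: "ext f (map Tm w) = w"
  by (induction w) auto

definition valuation :: "('n, 't) grammar \<Rightarrow> ('n \<Rightarrow> 't list) \<Rightarrow> bool" where
  "valuation G f \<longleftrightarrow> (\<forall>(A, w) \<in> prods G. f A = ext f w)"

lemma derive_ext:
  assumes "valuation G f" "(derive1 G)\<^sup>*\<^sup>* u v"
  shows "ext f u = ext f v"
  using assms(2)
proof (induction rule: rtranclp_induct)
  case (step y z)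
  then show ?case using assms(1)
    by (auto simp: valuation_def elim!: derive1.cases)
qed simp

lemma derive1_context:
  assumes "derive1 G u v" shows "derive1 G (x @ u @ y) (x @ v @ y)"
  using assms
proof cases
  case (1 A w u' v')
  then show ?thesis using derive1.intros[of A w G "x @ u'" "v' @ y"] by simp
qed

lemma derive_context:
  assumes "(derive1 G)\<^sup>*\<^sup>* u v" shows "(derive1 G)\<^sup>*\<^sup>* (x @ u @ y) (x @ v @ y)"
  using assms
  by (induction rule: rtranclp_induct) (auto intro: rtranclp.rtrancl_into_rtrancl derive1_context)

lemma derive_append:
  assumes "(derive1 G)\<^sup>*\<^sup>* u u'" "(derive1 G)\<^sup>*\<^sup>* v v'"
  shows "(derive1 G)\<^sup>*\<^sup>* (u @ v) (u' @ v')"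
proof -
  have "(derive1 G)\<^sup>*\<^sup>* (u @ v) (u' @ v)" using derive_context[OF assms(1), of "[]" v] by simp
  moreover have "(derive1 G)\<^sup>*\<^sup>* (u' @ v) (u' @ v')"
    using derive_context[OF assms(2), of u' "[]"] by simp
  ultimately show ?thesis by (rule rtranclp_trans)
qed

definition calls :: "('n, 't) grammar \<Rightarrow> ('n \<times> 'n) set" where
  "calls G = {(A, B). A \<in> nonterms G \<and> B \<in> nonterms G \<and> (\<exists>w. (A, w) \<in> prods G \<and> Nt B \<in> set w)}"

lemma slp_prodsD:
  assumes "slp G" "(A, w) \<in> prods G"
  shows "A \<in> nonterms G" "w \<noteq> []" "set w \<subseteq> Nt ` nonterms G \<union> Tm ` alphabet G"
proof -
  have "\<forall>p \<in> prods G. case p of (A, w) \<Rightarrow>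
      A \<in> nonterms G \<and> w \<noteq> [] \<and> set w \<subseteq> Nt ` nonterms G \<union> Tm ` alphabet G"
    using assms(1) unfolding slp_def by (elim conjE)
  from bspec[OF this assms(2)]
  show "A \<in> nonterms G" "w \<noteq> []" "set w \<subseteq> Nt ` nonterms G \<union> Tm ` alphabet G" by auto
qed

lemma slp_wf: assumes "slp G" shows "wf ((calls G)\<inverse>)"
proof -
  have "calls G \<subseteq> nonterms G \<times> nonterms G" by (auto simp: calls_def)
  then have "finite (calls G)" using assms unfolding slp_def by (meson finite_SigmaI finite_subset)
  moreover have "acyclic (calls G)" using assms unfolding slp_def calls_def by blast
  ultimately show ?thesis by (rule finite_acyclic_wf_converse)
qed

lemma slp_derives:
  assumes "slp G" "A \<in> nonterms G"
  shows "\<exists>w. (derive1 G)\<^sup>*\<^sup>* [Nt A] (map Tm w)"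
  using slp_wf[OF assms(1)] assms(2)
proof (induction A rule: wf_induct_rule)
  case (less A)
  obtain w where w: "(A, w) \<in> prods G" using assms(1) less.prems unfolding slp_def by blast
  have N: "B \<in> nonterms G" if "Nt B \<in> set w" for B
    using slp_prodsD(3)[OF assms(1) w] that by auto
  have IH: "\<exists>v. (derive1 G)\<^sup>*\<^sup>* [Nt B] (map Tm v)" if "Nt B \<in> set w" for B
    using less.IH[of B] N[OF that] w that less.prems by (auto simp: calls_def)
  have "\<exists>v. (derive1 G)\<^sup>*\<^sup>* u (map Tm v)" if "set u \<subseteq> set w" for u
    using that
  proof (induction u)
    case Nil then show ?case by (intro exI[of _ "[]"]) simp
  next
    case (Cons s u)
    then obtain v where v: "(derive1 G)\<^sup>*\<^sup>* u (map Tm v)" by auto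
    have "\<exists>v. (derive1 G)\<^sup>*\<^sup>* [s] (map Tm v)"
    proof (cases s)
      case (Tm a)
      then show ?thesis by (intro exI[of _ "[a]"]) simp
    qed (use IH Cons.prems in auto)
    then obtain v' where "(derive1 G)\<^sup>*\<^sup>* [s] (map Tm v')" by auto
    from derive_append[OF this v] show ?case by (intro exI[of _ "v' @ v"]) simp
  qed
  then obtain v where "(derive1 G)\<^sup>*\<^sup>* w (map Tm v)" by blast
  moreover have "derive1 G [Nt A] w" using derive1.intros[OF w, of "[]" "[]"] by simp
  ultimately show ?case by (meson converse_rtranclp_into_rtranclp)
qed

lemma slp_rhs_unique:
  assumes "slp G" "(A, w) \<in> prods G" "(A, v) \<in> prods G" shows "w = v"
proof -
  have "A \<in> nonterms G" using slp_prodsD(1)[OF assms(1,2)] .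
  then show ?thesis using assms unfolding slp_def by blast
qed

lemma slp_valuation: assumes "slp G" shows "\<exists>f. valuation G f"
proof -
  define F where "F f A = ext f (THE w. (A, w) \<in> prods G)" for f :: "'a \<Rightarrow> 'b list" and A
  define f where "f = wfrec ((calls G)\<inverse>) F"
  have "f A = ext f w" if w: "(A, w) \<in> prods G" for A w
  proof -
    have *: "(THE w. (A, w) \<in> prods G) = w" using slp_rhs_unique[OF assms] w by blast
    have A: "A \<in> nonterms G" "\<And>B. Nt B \<in> set w \<Longrightarrow> B \<in> nonterms G"
      using slp_prodsD(1,3)[OF assms w] by auto
    have C: "cut f ((calls G)\<inverse>) A B = f B" if "Nt B \<in> set w" for B
    proof -
      have "(A, B) \<in> calls G" using A w that by (auto simp: calls_def)
      then show ?thesis by (simp add: cut_apply)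
    qed
    have "f A = F (cut f ((calls G)\<inverse>) A) A"
      unfolding f_def by (rule wfrec[OF slp_wf[OF assms]])
    also have "\<dots> = ext (cut f ((calls G)\<inverse>) A) w" by (simp add: F_def *)
    also have "\<dots> = ext f w" unfolding ext_def
      by (rule arg_cong[of _ _ concat], rule map_cong)
        (auto split: sym.splits simp: C)
    finally show ?thesis .
  qed
  then show ?thesis unfolding valuation_def by auto
qed

lemma val_valuation:
  assumes "slp G" "valuation G f" "A \<in> nonterms G"
  shows "val_nt G A = f A" "(derive1 G)\<^sup>*\<^sup>* [Nt A] (map Tm w) \<longleftrightarrow> w = f A"
proof -
  have u: "w = f A" if "(derive1 G)\<^sup>*\<^sup>* [Nt A] (map Tm w)" for w
    using derive_ext[OF assms(2) that] by simp
  then show 1: "(derive1 G)\<^sup>*\<^sup>* [Nt A] (map Tm w) \<longleftrightarrow> w = f A" for w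
    using slp_derives[OF assms(1,3)] by auto
  show "val_nt G A = f A" unfolding val_nt_def 1 by simp
qed

lemma slp_val_unique:
  assumes "slp G" "A \<in> nonterms G"
  shows "\<exists>!w. (derive1 G)\<^sup>*\<^sup>* [Nt A] (map Tm w)"
  using val_valuation(2)[OF assms(1) _ assms(2)] slp_valuation[OF assms(1)] by metis


function cnt :: "'a list \<Rightarrow> 'a list \<Rightarrow> nat" where
  "cnt \<gamma> [] = 0"
| "cnt \<gamma> (a # w) =
     (if \<gamma> \<noteq> [] \<and> prefix \<gamma> (a # w) then Suc (cnt \<gamma> (drop (length \<gamma>) (a # w)))
      else cnt \<gamma> w)"
  by pat_completeness auto
termination
  by (relation "measure (\<lambda>(\<gamma>, w). length w)") (auto simp: less_Suc_eq_le neq_Nil_conv)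

lemma length_replace_word:
  assumes "\<gamma> \<noteq> []"
  shows "length (replace_word \<gamma> x w) + cnt \<gamma> w * (length \<gamma> - 1) = length w"
  using assms
proof (induction \<gamma> x w rule: replace_word.induct)
  case (2 \<gamma> x a w)
  show ?case
  proof (cases "prefix \<gamma> (a # w)")
    case True
    then have "length \<gamma> \<le> Suc (length w)" using prefix_length_le by force
    moreover have "length \<gamma> \<ge> 1" using 2(3) by (simp add: Suc_le_eq)
    ultimately show ?thesis using 2(1)[OF _ 2(3)] 2(3) True by auto
  qed (use 2 in auto)
qed simp

lemma cnt_ge_card:
  assumes "\<gamma> \<noteq> []" "\<forall>i\<in>Q. i + length \<gamma> \<le> length w \<and> take (length \<gamma>) (drop i w) = \<gamma>"
    "\<forall>i\<in>Q. \<forall>j\<in>Q. i < j \<longrightarrow> i + length \<gamma> \<le> j"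
  shows "card Q \<le> cnt \<gamma> w"
  using assms
proof (induction \<gamma> w arbitrary: Q rule: cnt.induct)
  case (1 \<gamma>)
  then have "Q = {}" by auto
  then show ?case by simp
next
  case (2 \<gamma> a w)
  let ?l = "length \<gamma>"
  have fin: "finite Q" by (rule finite_subset[of _ "{..Suc (length w)}"]) (use 2(4) in auto)
  show ?case
  proof (cases "prefix \<gamma> (a # w)")
    case True
    let ?Q = "{i. i + ?l \<in> Q}"
    have "card ?Q \<le> cnt \<gamma> (drop ?l (a # w))"
      by (rule 2(1)[OF _ 2(3)]) (use True 2 in \<open>force simp: add.commute\<close>)+
    moreover have "card Q \<le> Suc (card ?Q)"
    proof -
      let ?S = "{i\<in>Q. i < ?l}"
      have "card ?S \<le> Suc 0"
      proof -
        have "i = j" if "i \<in> ?S" "j \<in> ?S" for i j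
          using that 2(5) by (cases i j rule: linorder_cases) force+
        then show ?thesis using fin by (subst card_le_Suc0_iff_eq) auto
      qed
      moreover have "card {i\<in>Q. i \<ge> ?l} \<le> card ?Q"
      proof -
        have "{i\<in>Q. i \<ge> ?l} = (\<lambda>i. i + ?l) ` ?Q"
          by (auto simp: image_iff) (metis le_add_diff_inverse2)
        then show ?thesis by (simp add: card_image)
      qed
      moreover have "card Q \<le> card ?S + card {i\<in>Q. i \<ge> ?l}"
        by (rule order_trans[OF _ card_Un_le]) (use fin in \<open>auto intro!: card_mono\<close>)
      ultimately show ?thesis by linarith
    qed
    ultimately show ?thesis using True 2(3) by simp
  next
    case False
    let ?Q = "{i. Suc i \<in> Q}"
    have n: "0 \<notin> Q" using 2(4) False by (metis drop0 take_is_prefix)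
    have "card ?Q \<le> cnt \<gamma> w"
      by (rule 2(2)[OF _ 2(3)]) (use False 2 in \<open>force\<close>)+
    moreover have "Q = Suc ` ?Q" using n by (auto simp: image_iff) (metis not0_implies_Suc)
    then have "card Q = card ?Q" by (metis card_image inj_Suc)
    ultimately show ?thesis using False by simp
  qed
qed

lemma finite_occurrences:
  assumes "slp G" "\<gamma> \<noteq> []" shows "finite (occurrences G \<gamma>)"
proof -
  have "occurrences G \<gamma> \<subseteq> (\<Union>(A, w) \<in> prods G. {A} \<times> {..length w})"
    unfolding occurrences_def by (clarsimp, rule bexI) auto
  moreover have "finite \<dots>" using assms unfolding slp_def by auto
  ultimately show ?thesis by (rule finite_subset)
qed


lemma freq_attained:
  assumes "slp G" "\<gamma> \<noteq> []"
  obtains Q where "Q \<subseteq> occurrences G \<gamma>" "nonoverlapping (length \<gamma>) Q" "card Q = freq G \<gamma>"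
proof -
  let ?M = "{card Q | Q. Q \<subseteq> occurrences G \<gamma> \<and> nonoverlapping (length \<gamma>) Q}"
  have "?M \<subseteq> card ` Pow (occurrences G \<gamma>)" by auto
  then have "finite ?M" using finite_occurrences[OF assms] by (meson finite_Pow_iff finite_imageI finite_subset)
  moreover have "card {} \<in> ?M"
    by (rule CollectI, rule exI[of _ "{}"]) (auto simp: nonoverlapping_def)
  ultimately have "freq G \<gamma> \<in> ?M" unfolding freq_def by (intro Max_in) auto
  then show ?thesis using that by auto
qed

lemma freq_le_cnt:
  assumes "slp G" "\<gamma> \<noteq> []"
  shows "freq G \<gamma> \<le> (\<Sum>(A, w) \<in> prods G. cnt \<gamma> w)"
proof -
  obtain Q where Q: "Q \<subseteq> occurrences G \<gamma>" "nonoverlapping (length \<gamma>) Q" "card Q = freq G \<gamma>"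
    using freq_attained[OF assms] by metis
  have fP: "finite (prods G)" using assms unfolding slp_def by auto
  let ?q = "\<lambda>p. {i. (fst p, i) \<in> Q}"
  have "Q \<subseteq> (\<Union>p \<in> prods G. Pair (fst p) ` ?q p)"
    using Q(1) by (force simp: occurrences_def)
  moreover have finq: "finite (?q p)" for p
  proof -
    have "Pair (fst p) ` ?q p \<subseteq> occurrences G \<gamma>" using Q(1) by auto
    then show ?thesis using finite_occurrences[OF assms]
      by (metis finite_imageD finite_subset inj_on_def prod.inject)
  qed
  ultimately have "card Q \<le> card (\<Union>p \<in> prods G. Pair (fst p) ` ?q p)"
    using fP by (intro card_mono) auto
  also have "\<dots> \<le> (\<Sum>p \<in> prods G. card (Pair (fst p) ` ?q p))" by (rule card_UN_le[OF fP])
  also have "\<dots> \<le> (\<Sum>p \<in> prods G. cnt \<gamma> (snd p))"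
  proof (rule sum_mono)
    fix p assume p: "p \<in> prods G"
    obtain A w where pp: "p = (A, w)" by force
    have "card (Pair (fst p) ` ?q p) \<le> card (?q p)" by (rule card_image_le[OF finq])
    also have "\<dots> \<le> cnt \<gamma> (snd p)"
    proof (rule cnt_ge_card[OF assms(2)])
      show "\<forall>i\<in>?q p. i + length \<gamma> \<le> length (snd p) \<and> take (length \<gamma>) (drop i (snd p)) = \<gamma>"
      proof
        fix i assume "i \<in> ?q p"
        then obtain v where v: "(A, v) \<in> prods G" "i + length \<gamma> \<le> length v"
          "take (length \<gamma>) (drop i v) = \<gamma>"
          using Q(1) pp by (auto simp: occurrences_def)
        have "v = w" using slp_rhs_unique[OF assms(1) v(1)] p pp by simp
        with v pp show "i + length \<gamma> \<le> length (snd p) \<and> take (length \<gamma>) (drop i (snd p)) = \<gamma>" by simp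
      qed
    qed (use Q(2) in \<open>auto simp: nonoverlapping_def\<close>)
    finally show "card (Pair (fst p) ` ?q p) \<le> cnt \<gamma> (snd p)" .
  qed
  finally show ?thesis using Q(3) by (simp add: case_prod_unfold)
qed

lemma freq_pos_occ:
  assumes "slp G" "\<gamma> \<noteq> []" "freq G \<gamma> > 0"
  shows "\<exists>A w. (A, w) \<in> prods G \<and> length \<gamma> \<le> length w \<and> set \<gamma> \<subseteq> set w"
proof -
  obtain Q where Q: "Q \<subseteq> occurrences G \<gamma>" "card Q = freq G \<gamma>"
    using freq_attained[OF assms(1,2)] by metis
  then have "Q \<noteq> {}" using assms(3) by auto
  then obtain A i where "(A, i) \<in> occurrences G \<gamma>" using Q(1) by auto
  then obtain w where "(A, w) \<in> prods G" "i + length \<gamma> \<le> length w" "take (length \<gamma>) (drop i w) = \<gamma>"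
    by (auto simp: occurrences_def)
  then show ?thesis by (metis set_take_subset set_drop_subset subset_trans add_leD2)
qed

lemma ex_selection_rule: "\<exists>sel. selection_rule (sel :: (nat, 't) grammar \<Rightarrow> _)"
proof -
  have "\<exists>\<gamma>. most_frequent_maximal_string G \<gamma>"
    if G: "slp G" and m: "maximal_string G \<gamma>" for G :: "(nat, 't) grammar" and \<gamma>
  proof -
    let ?S = "{\<gamma>. maximal_string G \<gamma>}"
    let ?L = "\<Sum>(A, w) \<in> prods G. length w"
    have "?S \<subseteq> {u. set u \<subseteq> Nt ` nonterms G \<union> Tm ` alphabet G \<and> length u \<le> ?L}"
    proof safe
      fix \<delta> assume d: "maximal_string G \<delta>"
      have "\<delta> \<noteq> []" "freq G \<delta> > 0" using d unfolding maximal_string_def by auto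
      from freq_pos_occ[OF G this] obtain A w where w: "(A, w) \<in> prods G" "length \<delta> \<le> length w"
        "set \<delta> \<subseteq> set w" by blast
      have "length w \<le> ?L"
        using member_le_sum[OF w(1), of "\<lambda>(A, w). length w"] G unfolding slp_def by auto
      then show "length \<delta> \<le> ?L" using w by simp
      show "x \<in> Nt ` nonterms G" if "x \<in> set \<delta>" "x \<notin> Tm ` alphabet G" for x
        using slp_prodsD(3)[OF G w(1)] w(3) that by auto
    qed
    moreover have "finite \<dots>"
      by (rule finite_lists_length_le) (use G in \<open>auto simp: slp_def\<close>)
    ultimately have "finite ?S" by (rule finite_subset)
    then have f: "finite (freq G ` ?S)" by simp
    have "Max (freq G ` ?S) \<in> freq G ` ?S" by (rule Max_in[OF f]) (use m in auto)
    then obtain \<delta> where "maximal_string G \<delta>" "freq G \<delta> = Max (freq G ` ?S)" by auto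
    then show ?thesis using f unfolding most_frequent_maximal_string_def by (intro exI[of _ \<delta>]) auto
  qed
  then show ?thesis unfolding selection_rule_def
    by (intro exI[of _ "\<lambda>G. SOME \<gamma>. most_frequent_maximal_string G \<gamma>"]) (auto intro: someI2_ex)
qed

lemma set_replace_word: "set (replace_word \<gamma> x w) \<subseteq> insert x (set w)"
proof (induction \<gamma> x w rule: replace_word.induct)
  case (2 \<gamma> x a w)
  have "set (drop (length \<gamma>) (a # w)) \<subseteq> set (a # w)" by (rule set_drop_subset)
  then show ?case using 2 by auto
qed simp

lemma replace_word_Nil: "replace_word \<gamma> x w = [] \<longleftrightarrow> w = []"
  by (cases w) auto

lemma new_in_replace_word: "x \<in> set (replace_word \<gamma> x w) \<Longrightarrow> x \<in> set w \<or> set \<gamma> \<subseteq> set w"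
proof (induction \<gamma> x w rule: replace_word.induct)
  case (2 \<gamma> x a w)
  have "set (drop (length \<gamma>) (a # w)) \<subseteq> set (a # w)" by (rule set_drop_subset)
  then show ?case using 2 set_mono_prefix[of \<gamma> "a # w"] by (auto split: if_splits)
qed simp

lemma ext_cong: "(\<And>A. Nt A \<in> set u \<Longrightarrow> f A = g A) \<Longrightarrow> ext f u = ext g u"
  by (induction u) (auto simp: ext_def split: sym.splits)

lemma ext_replace_word:
  fixes f :: "'a \<Rightarrow> 't list"
  shows "f X = ext f \<gamma> \<Longrightarrow> ext f (replace_word \<gamma> (Nt X) w) = ext f w"
proof (induction \<gamma> "Nt X :: ('a, 't) sym" w rule: replace_word.induct)
  case (2 \<gamma> a w)
  show ?case
  proof (cases "\<gamma> \<noteq> [] \<and> prefix \<gamma> (a # w)")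
    case True
    then obtain v where v: "a # w = \<gamma> @ v" by (auto simp: prefix_def)
    have "ext f (replace_word \<gamma> (Nt X) (a # w)) = ext f \<gamma> @ ext f (drop (length \<gamma>) (a # w))"
      using 2 True by simp
    also have "\<dots> = ext f (a # w)" unfolding v by simp
    finally show ?thesis .
  next
    case False
    then show ?thesis using 2 by (cases a) auto
  qed
qed simp

context
  fixes G :: "(nat, 't) grammar" and \<gamma> X
  assumes G: "slp G" and m: "maximal_string G \<gamma>"
  defines "X \<equiv> fresh G"
begin

lemma fresh_notin: "X \<notin> nonterms G"
  unfolding X_def fresh_def by (rule LeastI_ex) (use G ex_new_if_finite in \<open>auto simp: slp_def\<close>)

lemma maximal_nonempty: "\<gamma> \<noteq> []" "length \<gamma> \<ge> 2" "freq G \<gamma> \<ge> 2"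
  using m unfolding maximal_string_def by auto

lemma maximal_set: "set \<gamma> \<subseteq> Nt ` nonterms G \<union> Tm ` alphabet G"
proof -
  have "freq G \<gamma> > 0" using maximal_nonempty(3) by simp
  from freq_pos_occ[OF G maximal_nonempty(1) this] show ?thesis using slp_prodsD(3)[OF G] by blast
qed

lemma prods_replace_string: "prods (replace_string \<gamma> G) =
  insert (X, \<gamma>) ((\<lambda>(A, w). (A, replace_word \<gamma> (Nt X) w)) ` prods G)"
  by (simp add: replace_string_def X_def)

lemma slp_replace_string: "slp (replace_string \<gamma> G)"
proof -
  let ?G = "replace_string \<gamma> G"
  have P: "A \<in> nonterms G" "w \<noteq> []" "set w \<subseteq> Nt ` nonterms G \<union> Tm ` alphabet G"
    if "(A, w) \<in> prods G" for A w using slp_prodsD[OF G that] by auto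
  have N: "nonterms ?G = insert X (nonterms G)" "alphabet ?G = alphabet G" "start ?G = start G"
    by (simp_all add: replace_string_def X_def)
  have acy: "acyclic (calls ?G)"
  proof -
    have acG: "(a, a) \<notin> (calls G)\<^sup>+" for a
      using G unfolding slp_def calls_def acyclic_def by blast
    have step: "(a \<noteq> X \<and> b \<noteq> X \<and> (a, b) \<in> calls G) \<or>
       (a \<noteq> X \<and> b = X \<and> (\<forall>c. Nt c \<in> set \<gamma> \<longrightarrow> (a, c) \<in> calls G)) \<or>
       (a = X \<and> b \<noteq> X \<and> Nt b \<in> set \<gamma>)" if "(a, b) \<in> calls ?G" for a b
    proof -
      from that obtain v where v: "(a, v) \<in> prods ?G" "Nt b \<in> set v" by (auto simp: calls_def)
      show ?thesis
      proof (cases "a = X")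
        case True
        then have "v = \<gamma>" using v(1) P(1) fresh_notin by (auto simp: prods_replace_string)
        then show ?thesis using True v maximal_set fresh_notin by auto
      next
        case False
        then obtain w where w: "(a, w) \<in> prods G" "v = replace_word \<gamma> (Nt X) w"
          using v(1) by (auto simp: prods_replace_string)
        show ?thesis
        proof (cases "b = X")
          case True
          have "Nt X \<notin> set w" using P(3)[OF w(1)] fresh_notin by auto
          then have "set \<gamma> \<subseteq> set w" using new_in_replace_word v(2) w(2) True by metis
          then show ?thesis using True False w P[OF w(1)] by (fastforce simp: calls_def)
        next
          case b: False
          then have "Nt b \<in> set w" using set_replace_word v(2) w(2) by fastforce
          then show ?thesis using b False w P[OF w(1)] by (fastforce simp: calls_def)
        qed
      qed
    qed
    have "(a \<noteq> X \<and> b \<noteq> X \<and> (a, b) \<in> (calls G)\<^sup>+) \<or>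
       (a \<noteq> X \<and> b = X \<and> (\<forall>c. Nt c \<in> set \<gamma> \<longrightarrow> (a, c) \<in> (calls G)\<^sup>+)) \<or>
       (a = X \<and> b \<noteq> X \<and> (\<exists>c. Nt c \<in> set \<gamma> \<and> (c, b) \<in> (calls G)\<^sup>*))"
      if "(a, b) \<in> (calls ?G)\<^sup>+" for a b
      using that
    proof (induction rule: trancl_induct)
      case (base y) then show ?case using step[OF base] by blast
    next
      case (step y z)
      from step(3) show ?case
      proof (elim disjE conjE exE)
        assume a: "a \<noteq> X" "y \<noteq> X" "(a, y) \<in> (calls G)\<^sup>+"
        then show ?thesis using \<open>\<And>a b. (a, b) \<in> calls ?G \<Longrightarrow> _\<close>[OF step(2)]
          by (meson trancl.trancl_into_trancl)
      next
        assume a: "a \<noteq> X" "y = X" "\<forall>c. Nt c \<in> set \<gamma> \<longrightarrow> (a, c) \<in> (calls G)\<^sup>+"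
        then show ?thesis using \<open>\<And>a b. (a, b) \<in> calls ?G \<Longrightarrow> _\<close>[OF step(2)] by blast
      next
        fix c assume a: "a = X" "y \<noteq> X" "Nt c \<in> set \<gamma>" "(c, y) \<in> (calls G)\<^sup>*"
        show ?thesis
        proof (cases "z = X")
          case True
          then have "(y, c) \<in> calls G"
            using \<open>\<And>a b. (a, b) \<in> calls ?G \<Longrightarrow> _\<close>[OF step(2)] a by blast
          then have "(c, c) \<in> (calls G)\<^sup>+" using a(4) by (rule rtrancl_into_trancl1[rotated])
          then show ?thesis using acG by blast
        next
          case False
          then have "(y, z) \<in> calls G"
            using \<open>\<And>a b. (a, b) \<in> calls ?G \<Longrightarrow> _\<close>[OF step(2)] a by blast
          then show ?thesis using a False by (meson rtrancl.rtrancl_into_rtrancl)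
        qed
      qed
    qed
    then show ?thesis using acG unfolding acyclic_def by blast
  qed
  have wf1: "A \<in> nonterms ?G \<and> v \<noteq> [] \<and> set v \<subseteq> Nt ` nonterms ?G \<union> Tm ` alphabet ?G"
    if "(A, v) \<in> prods ?G" for A v
  proof -
    from that consider "A = X" "v = \<gamma>" | w where "(A, w) \<in> prods G" "v = replace_word \<gamma> (Nt X) w"
      by (auto simp: prods_replace_string)
    then show ?thesis
    proof cases
      case 1 then show ?thesis using maximal_nonempty maximal_set N by auto
    next
      case 2
      then show ?thesis using P[OF 2(1)] set_replace_word[of \<gamma> "Nt X" w] N
        by (auto simp: replace_word_Nil)
    qed
  qed
  have un: "\<exists>!v. (A, v) \<in> prods ?G" if "A \<in> nonterms ?G" for A
  proof (cases "A = X")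
    case True
    then have "(A, v) \<in> prods ?G \<longleftrightarrow> v = \<gamma>" for v using P(1) fresh_notin by (auto simp: prods_replace_string)
    then show ?thesis by simp
  next
    case False
    then have "A \<in> nonterms G" using that N by simp
    then obtain w where w: "(A, w) \<in> prods G" using G unfolding slp_def by blast
    have "(A, v) \<in> prods ?G \<longleftrightarrow> v = replace_word \<gamma> (Nt X) w" for v
    proof
      assume "(A, v) \<in> prods ?G"
      then obtain u where "(A, u) \<in> prods G" "v = replace_word \<gamma> (Nt X) u"
        using False by (auto simp: prods_replace_string)
      then show "v = replace_word \<gamma> (Nt X) w" using slp_rhs_unique[OF G w] by blast
    next
      assume "v = replace_word \<gamma> (Nt X) w"
      then show "(A, v) \<in> prods ?G" unfolding prods_replace_string by (intro insertI2 image_eqI[OF _ w]) simp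
    qed
    then show ?thesis by simp
  qed
  have fin: "finite (nonterms ?G)" "finite (alphabet ?G)" "finite (prods ?G)" "start ?G \<in> nonterms ?G"
    using G unfolding slp_def N prods_replace_string by auto
  have all: "\<forall>p \<in> prods ?G. case p of (A, v) \<Rightarrow>
      A \<in> nonterms ?G \<and> v \<noteq> [] \<and> set v \<subseteq> Nt ` nonterms ?G \<union> Tm ` alphabet ?G"
    using wf1 by blast
  have un': "\<forall>A \<in> nonterms ?G. \<exists>!v. (A, v) \<in> prods ?G" using un by blast
  show ?thesis unfolding slp_def by (intro conjI fin all un' acy[unfolded calls_def])
qed

lemma val_replace_string: "val (replace_string \<gamma> G) = val G"
proof -
  obtain f where f: "valuation G f" using slp_valuation[OF G] by blast
  define f' where "f' = f(X := ext f \<gamma>)"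
  have e: "ext f' w = ext f w" if "set w \<subseteq> Nt ` nonterms G \<union> Tm ` alphabet G" for w
    by (rule ext_cong) (use that fresh_notin in \<open>auto simp: f'_def\<close>)
  have "valuation (replace_string \<gamma> G) f'"
    unfolding valuation_def prods_replace_string
  proof (safe, goal_cases)
    case 1 show ?case using e[OF maximal_set] by (simp add: f'_def)
  next
    case (2 A v B w)
    have P: "B \<in> nonterms G" "set w \<subseteq> Nt ` nonterms G \<union> Tm ` alphabet G"
      using slp_prodsD[OF G 2] by auto
    have "f' X = ext f' \<gamma>" using e[OF maximal_set] by (simp add: f'_def)
    from ext_replace_word[of f' X \<gamma>, OF this, of w] show ?case
      using e[OF P(2)] f 2 P(1) fresh_notin by (auto simp: f'_def valuation_def)
  qed
  moreover have s: "start (replace_string \<gamma> G) = start G" by (simp add: replace_string_def)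
  have "start G \<in> nonterms G" using G unfolding slp_def by blast
  ultimately show ?thesis
    using val_valuation(1)[OF G f] val_valuation(1)[OF slp_replace_string, of f' "start G"] fresh_notin unfolding val_def s
    by (auto simp: f'_def replace_string_def)
qed

lemma measure_replace_string:
  "(\<Sum>(A, w) \<in> prods (replace_string \<gamma> G). length w - 1) < (\<Sum>(A, w) \<in> prods G. length w - 1)"
proof -
  have fP: "finite (prods G)" using G unfolding slp_def by auto
  let ?h = "\<lambda>(A, w). (A, replace_word \<gamma> (Nt X) w)"
  have inj: "inj_on ?h (prods G)"
    by (auto simp: inj_on_def dest: slp_rhs_unique[OF G])
  have "(X, \<gamma>) \<notin> ?h ` prods G" using slp_prodsD(1)[OF G] fresh_notin by auto
  then have "(\<Sum>(A, w) \<in> prods (replace_string \<gamma> G). length w - 1) =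
     (length \<gamma> - 1) + (\<Sum>(A, w) \<in> prods G. length (replace_word \<gamma> (Nt X) w) - 1)"
    unfolding prods_replace_string using fP sum.reindex[OF inj, of "\<lambda>(A, w). length w - 1"]
    by (simp add: o_def case_prod_unfold)
  moreover have "(\<Sum>(A, w) \<in> prods G. length (replace_word \<gamma> (Nt X) w) - 1) +
      (\<Sum>(A, w) \<in> prods G. cnt \<gamma> w * (length \<gamma> - 1)) = (\<Sum>(A, w) \<in> prods G. length w - 1)"
    unfolding sum.distrib[symmetric] case_prod_unfold
  proof (rule sum.cong)
    fix p assume p: "p \<in> prods G"
    have "snd p \<noteq> []" using slp_prodsD(2)[OF G, of "fst p" "snd p"] p by simp
    then have "replace_word \<gamma> (Nt X) (snd p) \<noteq> []" by (simp add: replace_word_Nil)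
    then have "length (replace_word \<gamma> (Nt X) (snd p)) \<ge> 1" by (simp add: Suc_le_eq)
    then show "length (replace_word \<gamma> (Nt X) (snd p)) - 1 + cnt \<gamma> (snd p) * (length \<gamma> - 1) =
      length (snd p) - 1"
      using length_replace_word[OF maximal_nonempty(1), of "Nt X" "snd p"] by linarith
  qed simp
  moreover have "(\<Sum>(A, w) \<in> prods G. cnt \<gamma> w * (length \<gamma> - 1)) \<ge> 2 * (length \<gamma> - 1)"
    using freq_le_cnt[OF G maximal_nonempty(1)] maximal_nonempty(3) unfolding case_prod_unfold sum_distrib_right[symmetric]
    by (intro mult_right_mono) auto
  ultimately show ?thesis using maximal_nonempty(2) by linarith
qed

end

lemma slp_trivial_slp: assumes "w \<noteq> []" shows "slp (trivial_slp w)" "val (trivial_slp w) = w"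
proof -
  show s: "slp (trivial_slp w)"
  proof -
    have *: "{(A, B). A \<in> {0} \<and> B \<in> {0} \<and> (\<exists>v. (A, v) \<in> {(0, map Tm w)} \<and> Nt B \<in> set v)} = {}"
      by auto
    show ?thesis using assms unfolding slp_def trivial_slp_def grammar.simps *
      by (auto simp: acyclic_def)
  qed
  have "valuation (trivial_slp w) (\<lambda>_. w)" by (auto simp: trivial_slp_def valuation_def)
  from val_valuation(1)[OF s this, of 0] show "val (trivial_slp w) = w"
    by (simp add: val_def trivial_slp_def)
qed

theorem RePair_correct:
  fixes w :: "'t list"
  assumes sel: "selection_rule sel" and "w \<noteq> []"
  shows "slp (RePair sel w)" "val (RePair sel w) = w" "\<nexists>\<gamma>. maximal_string (RePair sel w) \<gamma>"
proof -
  let ?b = "\<lambda>G. \<exists>\<gamma>. maximal_string G \<gamma>" and ?c = "\<lambda>G. replace_string (sel G) G"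
  let ?R = "measure (\<lambda>G. \<Sum>(A, w) \<in> prods G. length w - 1)"
  have m: "maximal_string G (sel G)" if "slp G" "?b G" for G
    using sel that unfolding selection_rule_def most_frequent_maximal_string_def by blast
  have "(\<lambda>G. (slp G \<and> val G = w) \<and> \<not> ?b G) (while ?b ?c (trivial_slp w))"
  proof (rule while_rule[where P = "\<lambda>G. slp G \<and> val G = w" and r = "?R"])
    show "slp (trivial_slp w) \<and> val (trivial_slp w) = w" using slp_trivial_slp[OF assms(2)] by simp
  next
    fix G :: "(nat, 't) grammar" assume "slp G \<and> val G = w" and b: "?b G"
    then have G: "slp G" "val G = w" by auto
    from m[OF G(1) b] G show "slp (?c G) \<and> val (?c G) = w" "(?c G, G) \<in> ?R"
      using slp_replace_string[OF G(1)] val_replace_string[OF G(1)] measure_replace_string[OF G(1)] by auto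
  qed auto
  then show "slp (RePair sel w)" "val (RePair sel w) = w" "\<nexists>\<gamma>. maximal_string (RePair sel w) \<gamma>"
    unfolding RePair_def by auto
qed

end

theory Submission
  imports Defs
begin

text \<open>For exponents \<open>n\<^sub>1, \<dots>, n\<^sub>M\<close> and a huge padding exponent \<open>n\<^bsub>M+1\<^esub>\<close>, consider the word
  \<open>a^n\<^sub>1 b \<dots> a^n\<^bsub>M+1\<^esub> b\<close>. Because of the padding, RePair is forced to spend its first rounds on the rules
  \<open>X\<^sub>1 \<rightarrow> a a\<close>, \<open>X\<^sub>2 \<rightarrow> X\<^sub>1 X\<^sub>1\<close>, \<dots>, after which the start rule spells out the binary representations of
  \<open>n\<^sub>1, \<dots>, n\<^sub>M\<close>, with \<open>X\<^sub>p\<close> standing for a one at position \<open>p\<close>. Whatever RePair does afterwards, it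
  ends with a grammar for this word over the alphabet \<open>a, b, X\<^sub>1, X\<^sub>2, \<dots>\<close>, and a grammar of size \<open>s\<close>
  produces at most \<open>s L\<close> distinct factors of length \<open>L\<close>. Choose \<open>n\<^sub>i\<close> as the prefixes of one binary word in
  which every factor of length \<open>O(log M)\<close> occurs only once. Then the binary representations have about
  \<open>M\<^sup>2\<close> distinct factors of length \<open>L = O(log M)\<close>, so RePair's output has size at least about
  \<open>M\<^sup>2 / log M\<close>. On the other hand Horner's rule yields an SLP of size \<open>O(M)\<close>, and \<open>log n\<close> is of order \<open>M\<close>.\<close>

section \<open>RePair on unary blocks\<close>

lemma cnt_count_list_le: "cnt \<gamma> w * count_list \<gamma> z \<le> count_list w z"
proof (induction \<gamma> w rule: cnt.induct)
  case (2 \<gamma> a w)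
  show ?case
  proof (cases "\<gamma> \<noteq> [] \<and> prefix \<gamma> (a # w)")
    case True
    then obtain v where v: "a # w = \<gamma> @ v" by (auto simp: prefix_def)
    have "cnt \<gamma> v * count_list \<gamma> z \<le> count_list v z"
      using 2(1)[OF True] unfolding v by simp
    moreover have "drop (length \<gamma>) (a # w) = v" unfolding v by simp
    then have "cnt \<gamma> (a # w) = Suc (cnt \<gamma> v)" using True by simp
    moreover have "count_list (a # w) z = count_list \<gamma> z + count_list v z" unfolding v by simp
    ultimately show ?thesis by simp
  next
    case False
    have "cnt \<gamma> (a # w) = cnt \<gamma> w" using False by auto
    then show ?thesis using 2(2)[OF False] by (auto intro: le_SucI)
  qed
qed simp

text \<open>Non-overlapping copies of \<open>\<gamma>\<close> use up disjoint occurrences of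
  \<open>z\<close>. All upper bounds on frequencies below come from this.\<close>

lemma freq_count_list_le:
  assumes "slp G" "\<gamma> \<noteq> []"
  shows "freq G \<gamma> * count_list \<gamma> z \<le> (\<Sum>(A, w) \<in> prods G. count_list w z)"
proof -
  have "freq G \<gamma> * count_list \<gamma> z \<le> (\<Sum>(A, w) \<in> prods G. cnt \<gamma> w) * count_list \<gamma> z"
    using freq_le_cnt[OF assms] by simp
  also have "\<dots> \<le> (\<Sum>(A, w) \<in> prods G. count_list w z)"
    unfolding sum_distrib_right
    by (rule sum_mono) (auto simp: cnt_count_list_le)
  finally show ?thesis .
qed

lemma cnt_positions:
  "\<gamma> \<noteq> [] \<Longrightarrow> \<exists>Q. finite Q \<and> card Q = cnt \<gamma> w \<and>
     (\<forall>i\<in>Q. i + length \<gamma> \<le> length w \<and> take (length \<gamma>) (drop i w) = \<gamma>) \<and>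
     (\<forall>i\<in>Q. \<forall>j\<in>Q. i < j \<longrightarrow> i + length \<gamma> \<le> j)"
proof (induction \<gamma> w rule: cnt.induct)
  case (1 \<gamma>)
  then show ?case by (intro exI[of _ "{}"]) simp
next
  case (2 \<gamma> a w)
  let ?l = "length \<gamma>"
  show ?case
  proof (cases "prefix \<gamma> (a # w)")
    case True
    then obtain v where v: "a # w = \<gamma> @ v" by (auto simp: prefix_def)
    have d: "drop ?l (a # w) = v" unfolding v by simp
    obtain Q where Q: "finite Q" "card Q = cnt \<gamma> v"
      "\<forall>i\<in>Q. i + ?l \<le> length v \<and> take ?l (drop i v) = \<gamma>"
      "\<forall>i\<in>Q. \<forall>j\<in>Q. i < j \<longrightarrow> i + ?l \<le> j"
      using 2(1) True 2(3) unfolding d by blast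
    let ?Q = "insert 0 ((\<lambda>i. i + ?l) ` Q)"
    have c: "cnt \<gamma> (a # w) = Suc (cnt \<gamma> v)" using True 2(3) d by simp
    have "card ?Q = Suc (card Q)"
      using Q(1) 2(3) by (subst card_insert_disjoint) (auto simp: card_image)
    then have "card ?Q = cnt \<gamma> (a # w)" using Q(2) c by simp
    moreover have "\<forall>i\<in>?Q. i + ?l \<le> length (a # w) \<and> take ?l (drop i (a # w)) = \<gamma>"
      unfolding v using Q(3) by simp
    moreover have "\<forall>i\<in>?Q. \<forall>j\<in>?Q. i < j \<longrightarrow> i + ?l \<le> j" using Q(4) by auto
    moreover have "finite ?Q" using Q(1) by simp
    ultimately show ?thesis by (intro exI[of _ ?Q] conjI)
  next
    case False
    then obtain Q where Q: "finite Q" "card Q = cnt \<gamma> w"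
      "\<forall>i\<in>Q. i + ?l \<le> length w \<and> take ?l (drop i w) = \<gamma>"
      "\<forall>i\<in>Q. \<forall>j\<in>Q. i < j \<longrightarrow> i + ?l \<le> j"
      using 2 by blast
    have "card (Suc ` Q) = cnt \<gamma> (a # w)" using Q(2) False by (simp add: card_image)
    then show ?thesis using Q by (intro exI[of _ "Suc ` Q"]) auto
  qed
qed

text \<open>The positions found by the greedy scan form an admissible set in the maximum that
  defines \<open>freq\<close>.\<close>

lemma cnt_le_freq:
  assumes "slp G" "(A, w) \<in> prods G" "\<gamma> \<noteq> []"
  shows "cnt \<gamma> w \<le> freq G \<gamma>"
proof -
  obtain Q where Q: "card Q = cnt \<gamma> w"
    "\<forall>i\<in>Q. i + length \<gamma> \<le> length w \<and> take (length \<gamma>) (drop i w) = \<gamma>"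
    "\<forall>i\<in>Q. \<forall>j\<in>Q. i < j \<longrightarrow> i + length \<gamma> \<le> j"
    using cnt_positions[OF assms(3)] by metis
  let ?M = "{card Q | Q. Q \<subseteq> occurrences G \<gamma> \<and> nonoverlapping (length \<gamma>) Q}"
  have "?M \<subseteq> card ` Pow (occurrences G \<gamma>)" by auto
  then have fin: "finite ?M"
    using finite_occurrences[OF assms(1,3)] by (meson finite_Pow_iff finite_imageI finite_subset)
  have "Pair A ` Q \<subseteq> occurrences G \<gamma>" using Q(2) assms(2) unfolding occurrences_def by blast
  moreover have "nonoverlapping (length \<gamma>) (Pair A ` Q)" using Q(3) by (auto simp: nonoverlapping_def)
  moreover have "card (Pair A ` Q) = card Q" by (rule card_image) (simp add: inj_on_def)
  ultimately have "cnt \<gamma> w \<in> ?M" using Q(1) by (intro CollectI exI[of _ "Pair A ` Q"]) simp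
  then show ?thesis unfolding freq_def by (rule Max_ge[OF fin])
qed

section \<open>Halving the runs: the first rounds\<close>

lemma replace_word_avoid:
  assumes "x \<notin> set v" "\<gamma> \<noteq> []" "hd \<gamma> = x"
  shows "replace_word \<gamma> y (v @ w) = v @ replace_word \<gamma> y w"
  using assms by (induction v) (auto simp: prefix_def neq_Nil_conv)

text \<open>The condition on \<open>w\<close> keeps an odd leftover \<open>x\<close> from pairing
  with the letter after the run.\<close>

lemma replace_word_replicate:
  "w = [] \<or> hd w \<noteq> x \<Longrightarrow> replace_word [x, x] y (replicate c x @ w) =
     replicate (c div 2) y @ replicate (c mod 2) x @ replace_word [x, x] y w"
proof (induction c rule: induct_nat_012)
  case 1
  then show ?case by (cases w) auto
next
  case (ge2 n)
  then show ?case by simp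
qed simp

text \<open>The letters \<open>a\<close> and \<open>b\<close> are 1 and 2, and \<open>level j\<close> is the symbol \<open>X\<^sub>j\<close>, which produces \<open>a^(2^j)\<close>
  (with \<open>X\<^sub>0 = a\<close>). After \<open>j\<close> rounds a block \<open>a^n\<close> of the input has turned into \<open>block j n\<close>, and
  the SLP is \<open>halved_slp j ns\<close>.\<close>

fun bit_list :: "nat \<Rightarrow> nat \<Rightarrow> nat list" where
  "bit_list 0 n = []"
| "bit_list (Suc j) n = (if odd (n div 2 ^ j) then [j] else []) @ bit_list j n"

definition level :: "nat \<Rightarrow> (nat, nat) sym" where
  "level j = (if j = 0 then Tm 1 else Nt j)"

definition block :: "nat \<Rightarrow> nat \<Rightarrow> (nat, nat) sym list" where
  "block j n = replicate (n div 2 ^ j) (level j) @ map level (bit_list j n)"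

definition halved :: "nat \<Rightarrow> nat list \<Rightarrow> (nat, nat) sym list" where
  "halved j ns = concat (map (\<lambda>n. block j n @ [Tm 2]) ns)"

definition unary_word :: "nat list \<Rightarrow> nat list" where
  "unary_word ns = concat (map (\<lambda>n. replicate n 1 @ [2]) ns)"

definition halved_slp :: "nat \<Rightarrow> nat list \<Rightarrow> (nat, nat) grammar" where
  "halved_slp j ns = \<lparr>nonterms = {..j}, alphabet = set (unary_word ns),
     prods = insert (0, halved j ns) ((\<lambda>p. (Suc p, [level p, level p])) ` {..<j}), start = 0\<rparr>"

lemma inj_level: "inj level"
  by (auto simp: inj_def level_def split: if_splits)

lemma level_eq_iff [simp]: "level i = level j \<longleftrightarrow> i = j"
  using inj_level by (auto simp: inj_def)

lemma level_neq_2 [simp]: "level j \<noteq> Tm 2" "Tm 2 \<noteq> level j"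
  by (auto simp: level_def)

lemma set_bit_list: "set (bit_list j n) \<subseteq> {..<j}"
  by (induction j) (auto simp: less_Suc_eq)

lemma level_notin_bit_list: "level j \<notin> set (map level (bit_list j n))"
  using set_bit_list[of j n] by auto

lemma distinct_bit_list: "distinct (bit_list j n)"
  using set_bit_list by (induction j) fastforce+

lemma count_list_distinct: "distinct xs \<Longrightarrow> count_list xs x \<le> 1"
  by (induction xs) (auto simp: count_list_0_iff)

lemma halved_0: "halved 0 ns = map Tm (unary_word ns)"
  by (induction ns) (auto simp: halved_def unary_word_def block_def level_def)

lemma halved_slp_0: "halved_slp 0 ns = trivial_slp (unary_word ns)"
  by (auto simp: halved_slp_def trivial_slp_def halved_0)

text \<open>Only the leading run of a block contains the square of \<open>level j\<close>. Halving
  this run leaves as remainder the binary digit \<open>j\<close> of \<open>n\<close>, which is what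
  \<open>bit_list (Suc j) n\<close> has beyond \<open>bit_list j n\<close>.\<close>

lemma replace_word_halved:
  "replace_word [level j, level j] (level (Suc j)) (halved j ns) = halved (Suc j) ns"
proof (induction ns)
  case (Cons n ns)
  let ?b = "map level (bit_list j n) @ [Tm 2]" and ?x = "level j" and ?c = "n div 2 ^ j"
  have b: "?x \<notin> set ?b" using level_notin_bit_list[of j n] by simp
  have h: "hd (?b @ w) \<noteq> ?x" for w
    using b by (cases "map level (bit_list j n)") (auto simp: list.set_sel(1))
  have "replace_word [?x, ?x] (level (Suc j)) (halved j (n # ns)) =
      replace_word [?x, ?x] (level (Suc j)) (replicate ?c ?x @ (?b @ halved j ns))"
    by (simp add: halved_def block_def)
  also have "\<dots> = replicate (?c div 2) (level (Suc j)) @ replicate (?c mod 2) ?x @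
      replace_word [?x, ?x] (level (Suc j)) (?b @ halved j ns)"
    by (rule replace_word_replicate) (use h in blast)
  also have "replace_word [?x, ?x] (level (Suc j)) (?b @ halved j ns) = ?b @ halved (Suc j) ns"
    using replace_word_avoid[OF b, of "[?x, ?x]"] Cons by simp
  also have "replicate (?c div 2) (level (Suc j)) @ replicate (?c mod 2) ?x @ \<dots> =
      halved (Suc j) (n # ns)"
    by (auto simp: halved_def block_def odd_iff_mod_2_eq_one div_mult2_eq mult.commute[of 2]
        even_iff_mod_2_eq_zero)
  finally show ?case .
qed (simp add: halved_def)

lemma length_block_Suc: "length (block (Suc j) n) + n div 2 ^ j div 2 = length (block j n)"
proof -
  have "n div 2 ^ Suc j = n div 2 ^ j div 2" by (metis div_mult2_eq power_Suc2)
  then show ?thesis by (auto simp: block_def elim!: oddE evenE)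
qed

lemma length_halved_Suc:
  "length (halved (Suc j) ns) + (\<Sum>n\<leftarrow>ns. n div 2 ^ j div 2) = length (halved j ns)"
proof (induction ns)
  case (Cons n ns)
  then show ?case using length_block_Suc[of j n] by (simp add: halved_def)
qed (simp add: halved_def)

text \<open>Each replaced pair shortens the word by one, so the count can be read off from the
  lengths before and after the round.\<close>

lemma cnt_halved: "cnt [level j, level j] (halved j ns) = (\<Sum>n\<leftarrow>ns. n div 2 ^ j div 2)"
  using length_replace_word[of "[level j, level j]" "level (Suc j)" "halved j ns"]
    length_halved_Suc[of j ns] by (simp add: replace_word_halved)

lemma count_halved_level: "count_list (halved j ns) (level j) = (\<Sum>n\<leftarrow>ns. n div 2 ^ j)"
proof (induction ns)
  case (Cons n ns)
  have "count_list (map level (bit_list j n)) (level j) = 0"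
    using level_notin_bit_list by (simp add: count_list_0_iff)
  moreover have "count_list (replicate c x) x = c" for c and x :: "(nat, nat) sym"
    by (induction c) auto
  ultimately show ?case using Cons by (simp add: halved_def block_def)
qed (simp add: halved_def)

text \<open>Outside its leading run a block repeats no symbol: the digit positions are distinct, and
  the separator occurs once.\<close>

lemma count_halved_other: "z \<noteq> level j \<Longrightarrow> count_list (halved j ns) z \<le> length ns"
proof (induction ns)
  case (Cons n ns)
  have "count_list (map level (bit_list j n) @ [Tm 2]) z \<le> 1"
    by (rule count_list_distinct)
      (auto simp: distinct_map distinct_bit_list intro: inj_on_subset[OF inj_level])
  moreover have "count_list (replicate c (level j)) z = 0" for c
    using Cons.prems by (simp add: count_list_0_iff)
  ultimately show ?case using Cons.IH[OF Cons.prems] unfolding halved_def block_def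
    by (simp only: list.map concat.simps count_list_append append_assoc list.size)
qed (simp add: halved_def)

text \<open>The start symbol has number 0 and the levels use \<open>1\<close> to \<open>j\<close>,
  so \<open>fresh\<close> yields precisely the number of \<open>level (Suc j)\<close>. The earlier
  rules do not contain \<open>level j\<close> and stay as they are.\<close>

lemma replace_string_halved:
  "replace_string [level j, level j] (halved_slp j ns) = halved_slp (Suc j) ns"
proof -
  have f: "fresh (halved_slp j ns) = Suc j" unfolding fresh_def halved_slp_def
    by (rule Least_equality) auto
  have *: "replace_word [level j, level j] x [level p, level p] = [level p, level p]"
    if "p < j" for p and x
    using that by simp
  have N: "Nt (Suc j) = level (Suc j)" by (simp add: level_def)
  have "prods (replace_string [level j, level j] (halved_slp j ns)) = prods (halved_slp (Suc j) ns)"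
    unfolding replace_string_def f N
    by (simp add: halved_slp_def replace_word_halved lessThan_Suc image_image insert_commute *
        cong: image_cong_simp)
  moreover have "insert (Suc j) {..j} = {..Suc j}" by auto
  ultimately show ?thesis
    using f by (simp add: replace_string_def halved_slp_def)
qed


lemma prods_halved_slp:
  "prods (halved_slp j ns) =
     insert (0, halved j ns) ((\<lambda>p. (Suc p, [level p, level p])) ` {..<j})"
  by (simp add: halved_slp_def)

lemma sum_prods_halved_slp:
  "(\<Sum>(A, w) \<in> prods (halved_slp j ns). f w) =
     f (halved j ns) + (\<Sum>p<j. f [level p, level p])" for f :: "_ \<Rightarrow> nat"
proof -
  have "(\<Sum>(A, w) \<in> (\<lambda>p. (Suc p, [level p, level p])) ` {..<j}. f w) =
      (\<Sum>p<j. f [level p, level p])"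
    by (subst sum.reindex) (auto simp: inj_on_def)
  then show ?thesis unfolding prods_halved_slp by (subst sum.insert) auto
qed

lemma freq_halved_level:
  assumes "slp (halved_slp j ns)"
  shows "freq (halved_slp j ns) \<gamma> * count_list \<gamma> (level j) \<le> (\<Sum>n\<leftarrow>ns. n div 2 ^ j)"
proof (cases "\<gamma> = []")
  case False
  from freq_count_list_le[OF assms this, of "level j"] show ?thesis
    by (simp add: sum_prods_halved_slp count_halved_level)
qed simp

lemma freq_halved_other:
  assumes "slp (halved_slp j ns)" "z \<in> set \<gamma>" "z \<noteq> level j"
  shows "freq (halved_slp j ns) \<gamma> \<le> length ns + 2"
proof -
  let ?f = "freq (halved_slp j ns) \<gamma>"
  have ne: "\<gamma> \<noteq> []" using assms(2) by auto
  have c: "1 \<le> count_list \<gamma> z" using assms(2) by (metis One_nat_def Suc_leI count_list_0_iff gr0I)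
  \<comment> \<open>Besides the start rule, only the rule \<open>level p level p\<close> with
    \<open>level p = z\<close> contains \<open>z\<close>; this gives the \<open>+ 2\<close>.\<close>
  have "(\<Sum>p<j. count_list [level p, level p] z) \<le> 2"
  proof -
    have "(\<Sum>p<j. count_list [level p, level p] z) = (\<Sum>p | p < j \<and> level p = z. 2)"
      by (rule sum.mono_neutral_cong_right) auto
    moreover have "card {p. p < j \<and> level p = z} \<le> 1"
      by (rule card_le_Suc0_iff_eq[THEN iffD2, folded One_nat_def]) auto
    ultimately show ?thesis by simp
  qed
  moreover have "?f * 1 \<le> ?f * count_list \<gamma> z" by (rule mult_le_mono2[OF c])
  moreover note freq_count_list_le[OF assms(1) ne, of z] count_halved_other[OF assms(3), of ns]
  ultimately show ?thesis unfolding sum_prods_halved_slp mult_1_right by linarith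
qed

text \<open>As long as a block is long, every string other than \<open>X\<^sub>j X\<^sub>j\<close> is strictly rarer: it either contains
  a symbol that occurs at most once per block and in at most one short rule, or it is a longer power of \<open>X\<^sub>j\<close>.\<close>

lemma most_frequent_halved:
  assumes "slp (halved_slp j ns)" "(\<Sum>n\<leftarrow>ns. n div 2 ^ j) > 3 * length ns + 4" "ns \<noteq> []"
  shows "maximal_string (halved_slp j ns) [level j, level j]"
    "most_frequent_maximal_string (halved_slp j ns) \<delta> \<Longrightarrow> \<delta> = [level j, level j]"
proof -
  let ?G = "halved_slp j ns" and ?x = "level j"
  let ?T = "\<Sum>n\<leftarrow>ns. n div 2 ^ j"
  have "?T \<le> 2 * (\<Sum>n\<leftarrow>ns. n div 2 ^ j div 2) + length ns"
    by (induction ns) auto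
  moreover have "cnt [?x, ?x] (halved j ns) \<le> freq ?G [?x, ?x]"
    by (rule cnt_le_freq[OF assms(1)]) (auto simp: prods_halved_slp)
  ultimately have F: "?T \<le> 2 * freq ?G [?x, ?x] + length ns" by (simp add: cnt_halved)
  \<comment> \<open>With \<open>k = length ns\<close>, the pair has frequency at least
    \<open>(?T - k) / 2\<close>. Longer powers reach at most \<open>?T / 3\<close>, all other
    strings at most \<open>k + 2\<close>. The pair beats the latter exactly when
    \<open>?T > 3 * k + 4\<close>, which also suffices for the former.\<close>
  have less: "freq ?G \<delta> < freq ?G [?x, ?x]" if \<delta>: "length \<delta> \<ge> 2" "\<delta> \<noteq> [?x, ?x]" for \<delta>
  proof (cases "set \<delta> \<subseteq> {?x}")
    case True
    then have r: "\<delta> = replicate (length \<delta>) ?x" by (metis in_mono replicate_length_same singletonD)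
    have "length \<delta> \<noteq> 2" using \<delta>(2) r by (metis numeral_2_eq_2 replicate_0 replicate_Suc)
    then have "length \<delta> \<ge> 3" using \<delta>(1) by simp
    moreover have "count_list (replicate c ?x) ?x = c" for c by (induction c) auto
    then have "count_list \<delta> ?x = length \<delta>" using r by metis
    ultimately have "freq ?G \<delta> * 3 \<le> freq ?G \<delta> * count_list \<delta> ?x" by simp
    then show ?thesis using freq_halved_level[OF assms(1), of \<delta>] F assms(2) by linarith
  next
    case False
    then obtain z where "z \<in> set \<delta>" "z \<noteq> ?x" by auto
    from freq_halved_other[OF assms(1) this] show ?thesis using F assms(2) by linarith
  qed
  show m: "maximal_string ?G [?x, ?x]"
    unfolding maximal_string_def
  proof (intro conjI notI)
    show "2 \<le> freq ?G [?x, ?x]" using F assms(2) by linarith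
    assume "\<exists>\<delta>. length \<delta> > length [?x, ?x] \<and> freq ?G \<delta> \<ge> freq ?G [?x, ?x]"
    then obtain \<delta> where "length \<delta> > length [?x, ?x]" "freq ?G \<delta> \<ge> freq ?G [?x, ?x]" by blast
    then show False using less[of \<delta>] by force
  qed simp
  assume "most_frequent_maximal_string ?G \<delta>"
  then have "length \<delta> \<ge> 2" "freq ?G [?x, ?x] \<le> freq ?G \<delta>"
    using m unfolding most_frequent_maximal_string_def maximal_string_def by auto
  then show "\<delta> = [?x, ?x]" using less[of \<delta>] by force
qed

text \<open>In each of the first \<open>J\<close> rounds the most frequent maximal string is unique,
  so the selection rule has no choice and the loop can be unfolded \<open>J\<close> times.\<close>

lemma RePair_halved:
  assumes "selection_rule sel" "ns \<noteq> []"
    and "\<And>j. j < J \<Longrightarrow> (\<Sum>n\<leftarrow>ns. n div 2 ^ j) > 3 * length ns + 4"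
  shows "slp (halved_slp J ns)"
    "RePair sel (unary_word ns) =
       while (\<lambda>G. \<exists>\<gamma>. maximal_string G \<gamma>) (\<lambda>G. replace_string (sel G) G) (halved_slp J ns)"
proof -
  let ?b = "\<lambda>G. \<exists>\<gamma>. maximal_string G \<gamma>" and ?c = "\<lambda>G. replace_string (sel G) G"
  have "slp (halved_slp j ns) \<and> RePair sel (unary_word ns) = while ?b ?c (halved_slp j ns)"
    if "j \<le> J" for j
    using that
  proof (induction j)
    case 0
    have "unary_word ns \<noteq> []" using assms(2) by (cases ns) (auto simp: unary_word_def)
    then show ?case by (simp add: halved_slp_0 slp_trivial_slp RePair_def)
  next
    case (Suc j)
    let ?G = "halved_slp j ns"
    have IH: "slp ?G" "RePair sel (unary_word ns) = while ?b ?c ?G" using Suc by auto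
    note * = most_frequent_halved[OF IH(1) assms(3) assms(2)]
    have j: "j < J" using Suc.prems by simp
    have m: "maximal_string ?G [level j, level j]" by (rule *(1)[OF j])
    then have "most_frequent_maximal_string ?G (sel ?G)"
      using assms(1) IH(1) unfolding selection_rule_def by blast
    then have s: "sel ?G = [level j, level j]" by (rule *(2)[OF j])
    have "while ?b ?c ?G = (if ?b ?G then while ?b ?c (?c ?G) else ?G)" by (rule while_unfold)
    also have "\<dots> = while ?b ?c (?c ?G)" by (rule if_P) (use m in blast)
    also have "?c ?G = halved_slp (Suc j) ns" unfolding s by (rule replace_string_halved)
    finally have "while ?b ?c ?G = while ?b ?c (halved_slp (Suc j) ns)" .
    moreover have "slp (halved_slp (Suc j) ns)"
      using slp_replace_string[OF IH(1) m] by (simp add: replace_string_halved)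
    ultimately show ?case using IH by simp
  qed
  then show "slp (halved_slp J ns)" "RePair sel (unary_word ns) = while ?b ?c (halved_slp J ns)"
    by auto
qed


section \<open>Counting factors\<close>

definition factors :: "nat \<Rightarrow> 'a list \<Rightarrow> 'a list set" where
  "factors L w = {take L (drop i w) | i. i + L \<le> length w}"

lemma finite_factors [simp]: "finite (factors L w)"
proof -
  have "factors L w \<subseteq> (\<lambda>i. take L (drop i w)) ` {..length w}" by (auto simp: factors_def)
  then show ?thesis by (rule finite_subset) simp
qed

text \<open>A factor that crosses the boundary starts at one of the last \<open>L\<close> positions
  of \<open>u\<close>. The third set may be too large, but only its cardinality matters.\<close>

lemma factors_append:
  "factors L (u @ v) \<subseteq> factors L u \<union> factors L v \<union>
     (\<lambda>i. take L (drop i (u @ v))) ` {length u - L..<length u}"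
proof
  fix x assume "x \<in> factors L (u @ v)"
  then obtain i where i: "x = take L (drop i (u @ v))" "i + L \<le> length (u @ v)"
    by (auto simp: factors_def)
  consider "i + L \<le> length u" | "length u \<le> i" | "length u < i + L" "i < length u" by linarith
  then show "x \<in> factors L u \<union> factors L v \<union>
     (\<lambda>i. take L (drop i (u @ v))) ` {length u - L..<length u}"
  proof cases
    case 1
    then have "x = take L (drop i u)" using i by simp
    then show ?thesis using 1 by (auto simp: factors_def)
  next
    case 2
    then have "x = take L (drop (i - length u) v)" using i by simp
    then show ?thesis using 2 i by (auto simp: factors_def)
  next
    case 3
    then have "i \<in> {length u - L..<length u}" by auto
    then show ?thesis unfolding i(1) by blast
  qed
qed

lemma factors_concat:
  "L > 0 \<Longrightarrow> \<exists>C. finite C \<and> card C \<le> L * length ws \<and>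
     factors L (concat ws) \<subseteq> (\<Union>w\<in>set ws. factors L w) \<union> C"
proof (induction ws)
  case Nil
  then show ?case by (intro exI[of _ "{}"]) (simp add: factors_def)
next
  case (Cons u ws)
  then obtain C where C: "finite C" "card C \<le> L * length ws"
    "factors L (concat ws) \<subseteq> (\<Union>w\<in>set ws. factors L w) \<union> C" by auto
  let ?D = "(\<lambda>i. take L (drop i (u @ concat ws))) ` {length u - L..<length u}"
  have "card ?D \<le> card {length u - L..<length u}" by (rule card_image_le) simp
  then have "card ?D \<le> L" by simp
  then have "card (C \<union> ?D) \<le> L * length (u # ws)"
    using C(2) card_Un_le[of C ?D] by simp
  moreover have "factors L (concat (u # ws)) \<subseteq> (\<Union>w\<in>set (u # ws). factors L w) \<union> (C \<union> ?D)"
    using factors_append[of L u "concat ws"] C(3) by auto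
  ultimately show ?case using C(1) by (intro exI[of _ "C \<union> ?D"]) auto
qed

text \<open>The nonterminals in \<open>T\<close> are treated as terminals: the morphism \<open>h\<close> expands all the others.\<close>

definition partial_expansion ::
  "(nat, 't) grammar \<Rightarrow> nat set \<Rightarrow> ((nat, 't) sym \<Rightarrow> (nat, 't) sym list) \<Rightarrow> bool" where
  "partial_expansion G T h \<longleftrightarrow> (\<forall>a. h (Tm a) = [Tm a]) \<and> (\<forall>A\<in>T. h (Nt A) = [Nt A]) \<and>
     (\<forall>(A, w) \<in> prods G. A \<notin> T \<longrightarrow> h (Nt A) = concat (map h w))"

text \<open>A long factor of the expansion of \<open>A\<close> is either inherited from one of the symbols in the
  right-hand side of \<open>A\<close> or crosses one of the boundaries between these symbols.\<close>

lemma card_factors_le: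
  assumes "slp G" "partial_expansion G T h" "L \<ge> 2" "A \<in> nonterms G"
  shows "card (factors L (h (Nt A))) \<le> L * gsize G"
proof -
  note h = assms(2)[unfolded partial_expansion_def]
  have fin: "finite (prods G)" using assms(1) unfolding slp_def by auto
  \<comment> \<open>The boundary-crossing factors are fixed once per rule, so repeated uses of a
    nonterminal cost nothing extra.\<close>
  have "\<forall>p :: nat \<times> (nat, 'a) sym list. \<exists>C. finite C \<and> card C \<le> L * length (snd p) \<and>
      factors L (concat (map h (snd p))) \<subseteq> (\<Union>w\<in>set (map h (snd p)). factors L w) \<union> C"
  proof
    fix p :: "nat \<times> (nat, 'a) sym list"
    show "\<exists>C. finite C \<and> card C \<le> L * length (snd p) \<and>
      factors L (concat (map h (snd p))) \<subseteq> (\<Union>w\<in>set (map h (snd p)). factors L w) \<union> C"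
      using factors_concat[of L "map h (snd p)"] assms(3) by simp
  qed
  then obtain C where C: "\<And>p :: nat \<times> (nat, 'a) sym list. finite (C p)" "\<And>p. card (C p) \<le> L * length (snd p)"
    "\<And>p. factors L (concat (map h (snd p))) \<subseteq> (\<Union>w\<in>set (map h (snd p)). factors L w) \<union> C p"
    by metis
  \<comment> \<open>Single symbols contribute no factors because \<open>L\<close> is at least
    2.\<close>
  have short: "factors L [x] = {}" for x :: "(nat, 'a) sym" using assms(3) by (auto simp: factors_def)
  have "factors L (h (Nt A)) \<subseteq> (\<Union>p\<in>prods G. C p)"
    using slp_wf[OF assms(1)] assms(4)
  proof (induction A rule: wf_induct_rule)
    case (less A)
    show ?case
    proof (cases "A \<in> T")
      case True
      then show ?thesis using h short by simp
    next
      case False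
      obtain w where w: "(A, w) \<in> prods G" using assms(1) less.prems unfolding slp_def by blast
      have "factors L (h s) \<subseteq> (\<Union>p\<in>prods G. C p)" if s: "s \<in> set w" for s
      proof (cases s)
        case (Nt B)
        then have "B \<in> nonterms G" using slp_prodsD(3)[OF assms(1) w] s by auto
        then show ?thesis using less s w Nt by (auto simp: calls_def)
      next
        case (Tm a)
        then show ?thesis using h short by simp
      qed
      moreover have "h (Nt A) = concat (map h w)" using h False w by blast
      ultimately show ?thesis using C(3)[of "(A, w)"] w by fastforce
    qed
  qed
  then have "card (factors L (h (Nt A))) \<le> card (\<Union>p\<in>prods G. C p)"
    using fin C(1) by (intro card_mono) auto
  also have "\<dots> \<le> (\<Sum>p\<in>prods G. card (C p))" by (rule card_UN_le[OF fin])
  also have "\<dots> \<le> (\<Sum>p\<in>prods G. L * length (snd p))" by (rule sum_mono[OF C(2)])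
  also have "\<dots> = L * gsize G" by (simp add: gsize_def sum_distrib_left case_prod_unfold)
  finally show ?thesis .
qed

section \<open>Later rounds, seen over the enlarged alphabet\<close>

lemma concat_map_replace_word:
  "h x = concat (map h \<gamma>) \<Longrightarrow> concat (map h (replace_word \<gamma> x w)) = concat (map h w)"
proof (induction \<gamma> x w rule: replace_word.induct)
  case (2 \<gamma> x a w)
  show ?case
  proof (cases "\<gamma> \<noteq> [] \<and> prefix \<gamma> (a # w)")
    case True
    then obtain v where v: "a # w = \<gamma> @ v" by (auto simp: prefix_def)
    have d: "drop (length \<gamma>) (a # w) = v" unfolding v by simp
    have "concat (map h (replace_word \<gamma> x (a # w))) = h x @ concat (map h v)"
      using 2(1)[OF True 2(3)] True d by simp
    also have "\<dots> = concat (map h (a # w))" unfolding v using 2(3) by simp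
    finally show ?thesis .
  next
    case False
    have "replace_word \<gamma> x (a # w) = a # replace_word \<gamma> x w" using False by auto
    then show ?thesis using 2(2)[OF False 2(3)] by simp
  qed
qed simp

text \<open>The fresh nonterminal is expanded like \<open>\<gamma>\<close>. It lies outside
  \<open>T\<close> because \<open>T\<close> consists of old nonterminals, so \<open>T\<close> can
  remain fixed throughout the run.\<close>

lemma partial_expansion_replace_string:
  assumes "slp G" "maximal_string G \<gamma>" "partial_expansion G T h" "T \<subseteq> nonterms G"
  shows "\<exists>h'. partial_expansion (replace_string \<gamma> G) T h' \<and>
           (\<forall>A\<in>nonterms G. h' (Nt A) = h (Nt A))"
proof -
  let ?X = "fresh G"
  define h' where "h' = h(Nt ?X := concat (map h \<gamma>))"
  have X: "?X \<notin> nonterms G" by (rule fresh_notin[OF assms(1,2)])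
  have e: "concat (map h' w) = concat (map h w)"
    if "set w \<subseteq> Nt ` nonterms G \<union> Tm ` alphabet G" for w
    by (rule arg_cong[of _ _ concat], rule map_cong) (use X that in \<open>auto simp: h'_def\<close>)
  have hX: "h' (Nt ?X) = concat (map h' \<gamma>)"
    using e[OF maximal_set[OF assms(1,2)]] by (simp add: h'_def)
  have "partial_expansion (replace_string \<gamma> G) T h'"
    unfolding partial_expansion_def prods_replace_string[OF assms(1,2)]
  proof (intro conjI ballI allI, goal_cases)
    case (1 a)
    show ?case using assms(3) by (simp add: h'_def partial_expansion_def)
  next
    case (2 A)
    then have "A \<noteq> ?X" using X assms(4) by auto
    then show ?case using assms(3) 2 by (simp add: h'_def partial_expansion_def)
  next
    case (3 p)
    then consider "p = (?X, \<gamma>)"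
      | B w where "(B, w) \<in> prods G" "p = (B, replace_word \<gamma> (Nt ?X) w)" by auto
    then show ?case
    proof cases
      case 1
      then show ?thesis using hX by simp
    next
      case 2
      have "B \<noteq> ?X" using slp_prodsD(1)[OF assms(1) 2(1)] X by auto
      then have "h' (Nt B) = h (Nt B)" by (simp add: h'_def)
      moreover have "h (Nt B) = concat (map h w)" if "B \<notin> T"
        using assms(3) 2(1) that unfolding partial_expansion_def by blast
      moreover have "concat (map h' (replace_word \<gamma> (Nt ?X) w)) = concat (map h w)"
        using concat_map_replace_word[OF hX, of w] e[OF slp_prodsD(3)[OF assms(1) 2(1)]] by simp
      ultimately show ?thesis using 2(2) by simp
    qed
  qed
  moreover have "\<forall>A\<in>nonterms G. h' (Nt A) = h (Nt A)" using X by (auto simp: h'_def)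
  ultimately show ?thesis by blast
qed

text \<open>The loop invariant says that the start symbol still expands to
  \<open>halved J ns\<close> when \<open>X_1, ..., X_J\<close> count as letters. The rules of these
  nonterminals are unconstrained by the invariant, so later rounds may rewrite them.\<close>

lemma factors_le_RePair:
  assumes sel: "selection_rule sel" and "ns \<noteq> []" and "L \<ge> 2"
    and "\<And>j. j < J \<Longrightarrow> (\<Sum>n\<leftarrow>ns. n div 2 ^ j) > 3 * length ns + 4"
  shows "card (factors L (halved J ns)) \<le> L * gsize (RePair sel (unary_word ns))"
proof -
  let ?b = "\<lambda>G. \<exists>\<gamma>. maximal_string G \<gamma>" and ?c = "\<lambda>G. replace_string (sel G) G"
  let ?R = "measure (\<lambda>G. \<Sum>(A, w) \<in> prods G. length w - 1)" and ?T = "{1..J}"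
  let ?P = "\<lambda>G. slp G \<and> 0 \<in> nonterms G \<and> ?T \<subseteq> nonterms G \<and>
    (\<exists>h. partial_expansion G ?T h \<and> h (Nt 0) = halved J ns)"
  note J = RePair_halved[OF assms(1,2,4)]
  have m: "maximal_string G (sel G)" if "slp G" "?b G" for G
    using sel that unfolding selection_rule_def most_frequent_maximal_string_def by blast
  have "?P (while ?b ?c (halved_slp J ns))"
  proof (rule while_rule[where P = ?P and r = ?R])
    \<comment> \<open>Every nonterminal of \<open>halved_slp J ns\<close> except the start symbol 0
      belongs to \<open>?T\<close>, so one expansion step suffices.\<close>
    let ?h = "\<lambda>s. if s = Nt 0 then halved J ns else [s]"
    have "Nt 0 \<notin> set (halved J ns)"
      by (auto simp: halved_def block_def level_def split: if_splits)
    then have "map ?h (halved J ns) = map (\<lambda>s. [s]) (halved J ns)" by auto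
    also have "concat \<dots> = halved J ns" by simp
    finally have "concat (map ?h (halved J ns)) = halved J ns" .
    then have "partial_expansion (halved_slp J ns) ?T ?h"
      by (auto simp: partial_expansion_def prods_halved_slp)
    then show "?P (halved_slp J ns)" using J(1) by (auto simp: halved_slp_def)
  next
    fix G :: "(nat, nat) grammar" assume "?P G" and b: "?b G"
    then obtain h where G: "slp G" "0 \<in> nonterms G" "?T \<subseteq> nonterms G"
      "partial_expansion G ?T h" "h (Nt 0) = halved J ns" by blast
    note mG = m[OF G(1) b]
    have "insert (fresh G) (nonterms G) = nonterms (?c G)" by (simp add: replace_string_def)
    then show "?P (?c G)"
      using partial_expansion_replace_string[OF G(1) mG G(4,3)] G slp_replace_string[OF G(1) mG]
      by (metis insertCI subset_insertI2)
    show "(?c G, G) \<in> ?R" using measure_replace_string[OF G(1) mG] by simp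
  qed auto
  then have "?P (RePair sel (unary_word ns))" using J(2) by simp
  then obtain h where h: "slp (RePair sel (unary_word ns))" "0 \<in> nonterms (RePair sel (unary_word ns))"
    "partial_expansion (RePair sel (unary_word ns)) ?T h" "h (Nt 0) = halved J ns"
    by (elim conjE exE)
  from card_factors_le[OF h(1,3) assms(3) h(2)] show ?thesis using h(4) by simp
qed


section \<open>Small straight-line programs\<close>

lemma smallest_slp_size_le:
  fixes G :: "(nat, 't) grammar"
  assumes "slp G" "val G = w"
  shows "smallest_slp_size w \<le> gsize G"
  unfolding smallest_slp_size_def by (rule Least_le) (use assms in blast)

lemma smallest_slp_size_pos:
  assumes "w \<noteq> []"
  shows "smallest_slp_size w > 0"
proof -
  let ?P = "\<lambda>m. \<exists>G :: (nat, 'a) grammar. slp G \<and> val G = w \<and> gsize G = m"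
  have "?P (gsize (trivial_slp w))" using slp_trivial_slp[OF assms] by blast
  then have "?P (smallest_slp_size w)" unfolding smallest_slp_size_def by (rule LeastI)
  then obtain G :: "(nat, 'a) grammar" where G: "slp G" "gsize G = smallest_slp_size w" by blast
  obtain v where v: "(start G, v) \<in> prods G" using G(1) unfolding slp_def by blast
  have "length v \<le> gsize G"
    unfolding gsize_def using member_le_sum[OF v, of "\<lambda>(A, w). length w"] G(1)
    by (auto simp: slp_def)
  moreover have "v \<noteq> []" using slp_prodsD(2)[OF G(1) v] .
  ultimately show ?thesis using G(2) by (cases v) auto
qed

section \<open>SLPs with numerically ordered nonterminals, and Horner's rule\<close>

definition ordered_slp :: "(nat \<Rightarrow> (nat, 't) sym list) \<Rightarrow> nat \<Rightarrow> (nat, 't) grammar" where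
  "ordered_slp rhs n = \<lparr>nonterms = {..n}, alphabet = (\<Union>i\<le>n. {a. Tm a \<in> set (rhs i)}),
     prods = (\<lambda>i. (i, rhs i)) ` {..n}, start = n\<rparr>"

lemma ordered_slp:
  assumes "\<And>i. i \<le> n \<Longrightarrow> rhs i \<noteq> []" "\<And>i j. i \<le> n \<Longrightarrow> Nt j \<in> set (rhs i) \<Longrightarrow> j < i"
    and "\<And>i. i \<le> n \<Longrightarrow> f i = ext f (rhs i)"
  shows "slp (ordered_slp rhs n)" "val (ordered_slp rhs n) = f n"
    "gsize (ordered_slp rhs n) = (\<Sum>i\<le>n. length (rhs i))"
proof -
  let ?G = "ordered_slp rhs n"
  have p: "(i, w) \<in> prods ?G \<longleftrightarrow> i \<le> n \<and> w = rhs i" for i w by (auto simp: ordered_slp_def)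
  have "finite {a. Tm a \<in> set w}" for w :: "(nat, 'a) sym list"
    using finite_vimageI[of "set w" Tm] by (simp add: inj_def vimage_def)
  then have fin: "finite (nonterms ?G)" "finite (alphabet ?G)" "finite (prods ?G)"
    "start ?G \<in> nonterms ?G" by (auto simp: ordered_slp_def)
  have "calls ?G \<subseteq> {(A, B). B < A}" using assms(2) by (auto simp: calls_def p)
  moreover have "acyclic {(A, B :: nat). B < A}"
    by (rule acyclicI_order[where f = id]) auto
  ultimately have acy: "acyclic (calls ?G)" by (rule acyclic_subset[rotated])
  have all: "\<forall>(A, w) \<in> prods ?G. A \<in> nonterms ?G \<and> w \<noteq> [] \<and>
      set w \<subseteq> Nt ` nonterms ?G \<union> Tm ` alphabet ?G"
  proof (clarify, unfold p)
    fix A w assume A: "A \<le> n \<and> w = rhs A"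
    have "s \<in> Nt ` nonterms ?G \<union> Tm ` alphabet ?G" if s: "s \<in> set w" for s
    proof (cases s)
      case (Nt B)
      then have "B < A" using assms(2)[of A B] A s by simp
      then show ?thesis using Nt A by (auto simp: ordered_slp_def)
    next
      case (Tm a)
      then show ?thesis using s A by (auto simp: ordered_slp_def)
    qed
    then show "A \<in> nonterms ?G \<and> w \<noteq> [] \<and> set w \<subseteq> Nt ` nonterms ?G \<union> Tm ` alphabet ?G"
      using A assms(1) by (auto simp: ordered_slp_def)
  qed
  have un: "\<forall>A \<in> nonterms ?G. \<exists>!w. (A, w) \<in> prods ?G"
    unfolding p by (simp add: ordered_slp_def)
  show s: "slp ?G" unfolding slp_def by (intro conjI fin all un acy[unfolded calls_def])
  have "valuation ?G f" using assms(3) by (auto simp: valuation_def p)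
  from val_valuation(1)[OF s this, of n] show "val ?G = f n"
    by (simp add: val_def ordered_slp_def)
  have "inj_on (\<lambda>i. (i, rhs i)) {..n}" by (simp add: inj_on_def)
  then show "gsize ?G = (\<Sum>i\<le>n. length (rhs i))"
    by (simp add: gsize_def ordered_slp_def sum.reindex)
qed

text \<open>Horner's rule as an SLP: nonterminal \<open>i\<close> consists of \<open>q i\<close>
  copies of its predecessor and \<open>d i\<close> letters \<open>a\<close>, and the start rule
  \<open>n\<close> lists the chosen values with separators. Since \<open>0 - 1 = 0\<close>, the
  condition \<open>q 0 = 0\<close> prevents rule 0 from calling itself.\<close>

lemma smallest_slp_size_unary_word:
  fixes q d v :: "nat \<Rightarrow> nat"
  assumes "q 0 = 0" "\<And>i. i < n \<Longrightarrow> q i + d i > 0"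
    and "\<And>i. i < n \<Longrightarrow> v i = q i * v (i - 1) + d i"
    and "is \<noteq> []" "set is \<subseteq> {..<n}"
  shows "smallest_slp_size (unary_word (map v is)) \<le> (\<Sum>i<n. q i + d i) + 2 * length is"
proof -
  define rhs :: "nat \<Rightarrow> (nat, nat) sym list" where
    "rhs i = (if i < n then replicate (q i) (Nt (i - 1)) @ replicate (d i) (Tm 1)
    else concat (map (\<lambda>i. [Nt i, Tm 2]) is))" for i :: nat
  define f where "f i = (if i < n then replicate (v i) 1 else unary_word (map v is))" for i
  have er: "ext f (replicate c (Nt j)) = replicate (c * v j) 1" if "j < n" for c j
    using that by (induction c) (auto simp: f_def replicate_add)
  have et: "ext f (replicate c (Tm 1)) = replicate c 1" for c by (induction c) auto
  have es: "ext f (concat (map (\<lambda>i. [Nt i, Tm 2]) is)) = unary_word (map v is)"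
    using assms(5) by (induction "is") (auto simp: unary_word_def f_def)
  note o = ordered_slp[of n rhs f]
  have "rhs i \<noteq> []" if "i \<le> n" for i
    using assms(2)[of i] assms(4) by (cases "is") (auto simp: rhs_def)
  moreover have "j < i" if "i \<le> n" "Nt j \<in> set (rhs i)" for i j
    using that assms(1,5) by (cases "i = 0") (auto simp: rhs_def split: if_splits)
  moreover have "f i = ext f (rhs i)" if "i \<le> n" for i
    using er[of "i - 1" "q i"] et es assms(3)[of i] by (simp add: rhs_def f_def replicate_add)
  ultimately have s: "slp (ordered_slp rhs n)" "val (ordered_slp rhs n) = f n"
    "gsize (ordered_slp rhs n) = (\<Sum>i\<le>n. length (rhs i))"
    using o by blast+
  have "(\<Sum>i\<le>n. length (rhs i)) = (\<Sum>i<n. q i + d i) + length (rhs n)"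
    by (subst lessThan_Suc_atMost[symmetric]) (simp add: rhs_def)
  also have "length (rhs n) = 2 * length is" unfolding rhs_def by (induction "is") auto
  finally show ?thesis using smallest_slp_size_le[OF s(1), of "f n"] s by (simp add: f_def)
qed


section \<open>Exponents with unique factors\<close>

lemma bit_list_double: "bit_list (Suc j) (2 * n) = map Suc (bit_list j n)"
proof (induction j)
  case (Suc j)
  have "2 * n div 2 ^ Suc j = n div 2 ^ j" by simp
  then show ?case using Suc by simp
qed simp

lemma bit_list_double_Suc: "bit_list (Suc j) (Suc (2 * n)) = map Suc (bit_list j n) @ [0]"
proof (induction j)
  case (Suc j)
  have "Suc (2 * n) div 2 ^ Suc j = n div 2 ^ j" by (simp add: div_mult2_eq)
  then show ?case using Suc by simp
qed simp

lemma bit_list_shift: "bit_list (j + c) (2 ^ c * n) = map (\<lambda>e. e + c) (bit_list j n)"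
proof (induction c)
  case (Suc c)
  have "bit_list (j + Suc c) (2 ^ Suc c * n) = map Suc (bit_list (j + c) (2 ^ c * n))"
    using bit_list_double[of "j + c" "2 ^ c * n"] by (simp add: mult.assoc)
  then show ?case using Suc by simp
qed simp

lemma bit_list_shift_Suc:
  assumes "c > 0"
  shows "bit_list (j + c) (Suc (2 ^ c * n)) = map (\<lambda>e. e + c) (bit_list j n) @ [0]"
proof -
  obtain b where b: "c = Suc b" using assms gr0_conv_Suc by blast
  show ?thesis using bit_list_double_Suc[of "j + b" "2 ^ b * n"] bit_list_shift[of j b n]
    unfolding b by (simp add: mult.assoc)
qed

lemma bit_list_eq: "n < 2 ^ j \<Longrightarrow> j \<le> J \<Longrightarrow> bit_list J n = bit_list j n"
proof (induction J)
  case (Suc J)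
  show ?case
  proof (cases "j \<le> J")
    case True
    then have "(2::nat) ^ j \<le> 2 ^ J" by simp
    then have "n < 2 ^ J" using Suc.prems by linarith
    then show ?thesis using Suc True by simp
  next
    case False
    then have "j = Suc J" using Suc.prems by simp
    then show ?thesis by simp
  qed
qed simp

definition gap_sum :: "(nat \<Rightarrow> nat) \<Rightarrow> nat \<Rightarrow> nat" where
  "gap_sum g i = (\<Sum>t<i. g t)"

lemma gap_sum_simps [simp]: "gap_sum g 0 = 0" "gap_sum g (Suc i) = gap_sum g i + g i"
  by (simp_all add: gap_sum_def)

lemma gap_sum_mono: "i \<le> j \<Longrightarrow> gap_sum g i \<le> gap_sum g j"
  by (rule lift_Suc_mono_le) simp_all

text \<open>The binary representation of \<open>gap_number g i\<close> is the prefix with \<open>i\<close> ones of an infinite word in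
  which consecutive ones have distances \<open>g 0, g 1, \<dots>\<close>.\<close>

fun gap_number :: "(nat \<Rightarrow> nat) \<Rightarrow> nat \<Rightarrow> nat" where
  "gap_number g 0 = 0"
| "gap_number g (Suc i) = Suc (2 ^ g i * gap_number g i)"

lemma gap_number_less:
  assumes "\<And>i. g i > 0"
  shows "gap_number g i < 2 ^ gap_sum g i"
proof (induction i)
  case (Suc i)
  have "(2::nat) ^ 1 \<le> 2 ^ g i" using assms[of i] by (intro power_increasing) auto
  moreover have "2 ^ g i * Suc (gap_number g i) \<le> 2 ^ g i * 2 ^ gap_sum g i"
    using Suc by (intro mult_le_mono2) simp
  ultimately show ?case by (simp add: power_add mult.commute)
qed simp

text \<open>Each step of \<open>gap_number\<close> appends \<open>g i - 1\<close> zeros and a one.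
  Hence neighbouring ones with indices \<open>j\<close> and \<open>Suc j\<close> have distance
  \<open>g (Suc j)\<close>, while \<open>g 0\<close> only produces leading zeros.\<close>

lemma bit_list_gap_number:
  assumes "\<And>i. g i > 0"
  shows "bit_list (gap_sum g i) (gap_number g i) = map (\<lambda>j. gap_sum g i - gap_sum g (Suc j)) [0..<i]"
proof (induction i)
  case (Suc i)
  have "bit_list (gap_sum g (Suc i)) (gap_number g (Suc i)) =
      map (\<lambda>j. gap_sum g i - gap_sum g (Suc j) + g i) [0..<i] @ [0]"
    using bit_list_shift_Suc[OF assms, of "gap_sum g i" i] Suc by (simp add: o_def)
  also have "map (\<lambda>j. gap_sum g i - gap_sum g (Suc j) + g i) [0..<i] =
      map (\<lambda>j. gap_sum g (Suc i) - gap_sum g (Suc j)) [0..<i]"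
  proof (rule map_cong)
    fix j assume "j \<in> set [0..<i]"
    then have "gap_sum g (Suc j) \<le> gap_sum g i" by (intro gap_sum_mono) auto
    then show "gap_sum g i - gap_sum g (Suc j) + g i = gap_sum g (Suc i) - gap_sum g (Suc j)" by simp
  qed simp
  finally show ?case by simp
qed simp

text \<open>The gap 3 marks the beginning of each group of length \<open>m + 1\<close>; the other gaps of the \<open>x\<close>-th
  group encode the bits of \<open>x\<close>. Hence a factor of length \<open>2 * (m + 1)\<close> determines its position.\<close>

definition gap :: "nat \<Rightarrow> nat \<Rightarrow> nat" where
  "gap m t = (if t mod Suc m = 0 then 3 else if bit (t div Suc m) (t mod Suc m - 1) then 2 else 1)"

lemma gap_pos: "gap m t > 0" and gap_le: "gap m t \<le> 3"
  by (auto simp: gap_def)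

lemma gap_eq_3: "gap m t = 3 \<longleftrightarrow> t mod Suc m = 0"
  by (auto simp: gap_def)

lemma gap_bit:
  assumes "e < m"
  shows "gap m (x * Suc m + Suc e) = (if bit x e then 2 else 1)"
proof -
  have "(x * Suc m + Suc e) mod Suc m = Suc e" "(x * Suc m + Suc e) div Suc m = x"
    using assms by (subst mod_mult_self3 div_mult_self3; simp)+
  then show ?thesis unfolding gap_def by simp
qed

lemma nat_bits_eqI:
  fixes x y :: nat
  assumes "x < 2 ^ m" "y < 2 ^ m" "\<And>e. e < m \<Longrightarrow> bit x e = bit y e"
  shows "x = y"
proof -
  have "take_bit m x = take_bit m y" by (rule bit_eqI) (use assms(3) in \<open>auto simp: bit_take_bit_iff\<close>)
  then show ?thesis using assms(1,2) by (simp add: take_bit_nat_eq_self)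
qed

text \<open>Among the first \<open>Suc m\<close> gaps of the window there is a marker 3, and the
  \<open>m\<close> gaps after it spell the group number. The bounds on \<open>a\<close> and
  \<open>b\<close> keep this number below \<open>2 ^ m\<close>, so its \<open>m\<close> digits
  determine it.\<close>

lemma gap_unique:
  assumes "\<And>t. t < 2 * Suc m \<Longrightarrow> gap m (a + t) = gap m (b + t)"
    and "a + 2 * Suc m \<le> Suc m * 2 ^ m" "b + 2 * Suc m \<le> Suc m * 2 ^ m"
  shows "a = b"
proof -
  let ?K = "Suc m"
  \<comment> \<open>The distance from \<open>a\<close> to the next multiple of \<open>?K\<close>;
    the outer \<open>mod\<close> gives 0 if \<open>a\<close> is itself a multiple.\<close>
  define t where "t = (?K - a mod ?K) mod ?K"
  have t: "t < ?K" by (simp add: t_def)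
  have "(a + t) mod ?K = (a mod ?K + (?K - a mod ?K)) mod ?K"
    unfolding t_def by (metis mod_add_eq mod_mod_trivial)
  also have "a mod ?K + (?K - a mod ?K) = ?K" using mod_less_divisor[of ?K a] by linarith
  finally have a0: "(a + t) mod ?K = 0" by simp
  then have b0: "(b + t) mod ?K = 0" using assms(1)[of t] t by (simp flip: gap_eq_3)
  obtain x where x: "a + t = x * ?K" using a0 by (metis mod_0_imp_dvd dvd_div_mult_self)
  obtain y where y: "b + t = y * ?K" using b0 by (metis mod_0_imp_dvd dvd_div_mult_self)
  have "x * ?K < 2 ^ m * ?K" "y * ?K < 2 ^ m * ?K"
    using assms(2,3) t x y by (simp_all add: mult.commute)
  then have lt: "x < 2 ^ m" "y < 2 ^ m" by (metis mult_less_cancel2)+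
  have "bit x e = bit y e" if "e < m" for e
  proof -
    have "gap m (a + (t + Suc e)) = gap m (b + (t + Suc e))" using t that by (intro assms(1)) simp
    then have "gap m (x * ?K + Suc e) = gap m (y * ?K + Suc e)"
      using x y by (metis add.assoc)
    then show ?thesis using gap_bit[OF that] by (simp split: if_splits)
  qed
  then have "x = y" using nat_bits_eqI[OF lt] by blast
  then show ?thesis using x y by simp
qed

section \<open>Distinct factors of the halved word\<close>

lemma factors_mono: "factors L v \<subseteq> factors L (u @ v @ w)"
proof
  fix x assume "x \<in> factors L v"
  then obtain i where "x = take L (drop i v)" "i + L \<le> length v" by (auto simp: factors_def)
  then have "x = take L (drop (length u + i) (u @ v @ w))" "length u + i + L \<le> length (u @ v @ w)"
    by auto
  then show "x \<in> factors L (u @ v @ w)" unfolding factors_def by blast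
qed

text \<open>Since the number is below \<open>2 ^ J\<close>, its block has no run of
  \<open>level J\<close> and just lists its ones. Each symbol records the distance of a one from the
  right end, so the same digits give different factors for different \<open>i\<close>.\<close>

lemma factor_halved:
  assumes "\<And>t. g t > 0" "gap_number g i \<in> set ns" "gap_sum g i \<le> J" "j + L \<le> i"
  shows "map (\<lambda>t. level (gap_sum g i - gap_sum g (Suc (j + t)))) [0..<L] \<in> factors L (halved J ns)"
proof -
  let ?n = "gap_number g i"
  have n: "?n < 2 ^ gap_sum g i" by (rule gap_number_less[OF assms(1)])
  also have "(2::nat) ^ gap_sum g i \<le> 2 ^ J" using assms(3) by simp
  finally have "block J ?n = map level (bit_list J ?n)" by (simp add: block_def)
  also have "\<dots> = map (\<lambda>j. level (gap_sum g i - gap_sum g (Suc j))) [0..<i]"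
    unfolding bit_list_eq[OF n assms(3)] bit_list_gap_number[OF assms(1)] by simp
  finally have b: "block J ?n = map (\<lambda>j. level (gap_sum g i - gap_sum g (Suc j))) [0..<i]" .
  have "map (\<lambda>t. level (gap_sum g i - gap_sum g (Suc (j + t)))) [0..<L] = take L (drop j (block J ?n))"
    unfolding b using assms(4) by (intro nth_equalityI) auto
  then have "map (\<lambda>t. level (gap_sum g i - gap_sum g (Suc (j + t)))) [0..<L] \<in> factors L (block J ?n)"
    using assms(4) unfolding factors_def b by auto
  moreover obtain xs ys where "ns = xs @ ?n # ys" using assms(2) by (meson split_list)
  then have "halved J ns = halved J xs @ block J ?n @ (Tm 2 # halved J ys)" by (simp add: halved_def)
  ultimately show ?thesis
    using factors_mono[of L "block J ?n" "halved J xs" "Tm 2 # halved J ys"] by auto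
qed

lemma gap_sum_less: "(\<And>t. g t > 0) \<Longrightarrow> i < j \<Longrightarrow> gap_sum g i < gap_sum g j"
  by (rule lift_Suc_mono_less[of "gap_sum g"]) simp_all

text \<open>The pair \<open>(i, j)\<close> stands for the factor starting at one number
  \<open>j\<close> of \<open>gap_number (gap m) i\<close>. With \<open>M = 4 * B\<close> there are
  \<open>2 * B * B\<close>, that is, an eighth of the square of \<open>M\<close>, such pairs, and
  the factor determines its pair.\<close>

lemma card_factors_halved:
  assumes m: "m \<ge> 3" and M: "M = Suc m * 2 ^ m"
    and "\<And>i. i \<in> {1..M} \<Longrightarrow> gap_number (gap m) i \<in> set ns" "gap_sum (gap m) M \<le> J"
  shows "M\<^sup>2 \<le> 8 * card (factors (2 * m + 3) (halved J ns))"
proof -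
  define B where "B = Suc m * 2 ^ (m - 2)"
  let ?L = "2 * m + 3" and ?s = "gap_sum (gap m)"
  let ?x = "\<lambda>(i, j). map (\<lambda>t. level (?s i - ?s (Suc (j + t)))) [0..<?L]"
  let ?I = "{2 * B<..4 * B} \<times> {..<B}"
  have "(2::nat) ^ (2 + (m - 2)) = 4 * 2 ^ (m - 2)" unfolding power_add by simp
  moreover have "2 + (m - 2) = m" using m by linarith
  ultimately have "(2::nat) ^ m = 4 * 2 ^ (m - 2)" by metis
  then have MB: "M = 4 * B" unfolding M B_def by simp
  have "(2::nat) ^ 1 \<le> 2 ^ (m - 2)" using m by (intro power_increasing) auto
  then have "Suc m * 2 \<le> B" unfolding B_def by (intro mult_le_mono2) simp
  then have ij: "j + ?L \<le> i" if "(i, j) \<in> ?I" for i j using that by auto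
  have "?x p \<in> factors ?L (halved J ns)" if "p \<in> ?I" for p
  proof -
    obtain i j where p: "p = (i, j)" by force
    then have "i \<in> {1..M}" using MB that by auto
    moreover from this have "?s i \<le> J" using gap_sum_mono[of i M "gap m"] assms(4) by auto
    ultimately show ?thesis
      using factor_halved[of "gap m", OF gap_pos assms(3) _ ij[of i j]] that unfolding p by simp
  qed
  then have "?x ` ?I \<subseteq> factors ?L (halved J ns)" by (rule image_subsetI)
  moreover have "inj_on ?x ?I"
  proof (rule inj_onI)
    fix p p' assume p: "p \<in> ?I" "p' \<in> ?I" "?x p = ?x p'"
    obtain i j i' j' where ij_eq: "p = (i, j)" "p' = (i', j')" by (metis surj_pair)
    have i: "i \<in> {2 * B<..4 * B}" "j \<in> {..<B}" "i' \<in> {2 * B<..4 * B}" "j' \<in> {..<B}"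
      and e: "?x (i, j) = ?x (i', j')" using p unfolding ij_eq by blast+
    have ij: "j + ?L \<le> i" "j' + ?L \<le> i'" using ij[of i j] ij[of i' j'] i by auto
    have d: "?s i - ?s (Suc (j + t)) = ?s i' - ?s (Suc (j' + t))" if "t < ?L" for t
    proof -
      have "?x (i, j) ! t = ?x (i', j') ! t" by (simp only: e)
      then show ?thesis using that by simp
    qed
    have le: "?s (Suc (j + t)) \<le> ?s i" "?s (Suc (j' + t)) \<le> ?s i'" if "t < ?L" for t
      using ij that by (auto intro!: gap_sum_mono simp del: gap_sum_simps)
    \<comment> \<open>Differences of consecutive entries are gaps; \<open>2 * m + 3\<close> entries
      give the \<open>2 * Suc m\<close> gaps that \<open>gap_unique\<close> needs.\<close>
    have "gap m (Suc j + t) = gap m (Suc j' + t)" if "t < 2 * Suc m" for t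
      using d[of t] d[of "Suc t"] le[of "Suc t"] that by simp
    then have "Suc j = Suc j'"
      by (rule gap_unique) (use ij i MB M in auto)
    \<comment> \<open>Once \<open>j\<close> is known, the absolute position in the first entry
      reveals \<open>i\<close>.\<close>
    then have "?s i = ?s i'" using d[of 0] le[of 0] by simp
    then have "i = i'" using gap_sum_less[of "gap m", OF gap_pos] by (metis linorder_neq_iff)
    then show "p = p'" using \<open>Suc j = Suc j'\<close> by (simp add: ij_eq)
  qed
  ultimately have "card ?I \<le> card (factors ?L (halved J ns))"
    by (intro card_inj_on_le finite_factors)
  then have "2 * B * B \<le> card (factors ?L (halved J ns))" by (simp add: card_cartesian_product)
  then show ?thesis unfolding MB by (simp add: power2_eq_square)
qed


section \<open>The lower bound\<close>

lemma sum_list_ge_div: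
  fixes r :: nat
  assumes "r \<in> set ns"
  shows "r div 2 ^ j \<le> (\<Sum>n\<leftarrow>ns. n div 2 ^ j)"
  using assms by (induction ns) auto

lemma gap_sum_le: "gap_sum (gap m) i \<le> 3 * i"
  by (induction i) (use gap_le in \<open>auto intro: add_le_mono simp: add.commute\<close>)

lemma four_mult_less_power2: "i \<ge> 6 \<Longrightarrow> 4 * i + 9 \<le> (2::nat) ^ i"
  by (induction i rule: dec_induct) auto

lemma set_unary_word: "set (unary_word ns) \<subseteq> {1..2}"
  by (induction ns) (auto simp: unary_word_def)

lemma length_unary_word: "length (unary_word ns) = (\<Sum>n\<leftarrow>ns. Suc n)"
  by (induction ns) (auto simp: unary_word_def)

text \<open>One chain serves both parts: indices below \<open>M\<close> produce the gap numbers. At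
  index \<open>M\<close> it restarts with the leading digit of \<open>r\<close>, and further
  doublings reach \<open>r\<close> at \<open>M + Q\<close>. A rule costs at most
  \<open>8 + 1\<close> in the first part and 3 in the second; the start rule adds
  \<open>2 * Suc M\<close>.\<close>

lemma smallest_slp_size_gap_word:
  assumes "2 ^ Q \<le> r" "r < 2 ^ Suc Q" "M > 0"
  shows "smallest_slp_size (unary_word (map (gap_number (gap m)) [1..<Suc M] @ [r]))
    \<le> 11 * M + 3 * Q + 5"
proof -
  let ?g = "gap m" and ?n = "Suc (M + Q)"
  define q :: "nat \<Rightarrow> nat" where "q i = (if i = 0 \<or> i = M then 0 else if i < M then 2 ^ ?g i else 2)" for i
  define d where "d i = (if i < M then 1 else r div 2 ^ (M + Q - i) mod 2)" for i
  define v where "v i = (if i < M then gap_number ?g (Suc i) else r div 2 ^ (M + Q - i))" for i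
  let ?is = "[0..<M] @ [M + Q]"
  have rQ: "r div 2 ^ Q = 1"
    using assms(1,2) by (intro div_nat_eqI) auto
  have qd: "q i + d i > 0" for i
    using rQ by (auto simp: q_def d_def)
  have v: "v i = q i * v (i - 1) + d i" if "i < ?n" for i
  proof -
    consider "i = 0" "i < M" | k where "i = Suc k" "Suc k < M" | "i = M" | "i > M"
      using assms(3) by (metis linorder_neqE_nat not0_implies_Suc)
    then show ?thesis
    proof cases
      case 4
      let ?t = "M + Q - i"
      have t: "M + Q - (i - 1) = Suc ?t" "\<not> i - 1 < M" using 4 that by linarith+
      have "r div 2 ^ ?t = 2 * (r div 2 ^ ?t div 2) + r div 2 ^ ?t mod 2" by simp
      also have "r div 2 ^ ?t div 2 = r div 2 ^ Suc ?t" by (metis div_mult2_eq power_Suc2)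
      finally show ?thesis using 4 t by (simp add: v_def q_def d_def)
    qed (use rQ assms(3) in \<open>auto simp: v_def q_def d_def\<close>)
  qed
  have "map v [0..<M] = map (gap_number ?g) (map Suc [0..<M])" by (simp add: v_def)
  then have w: "map v ?is = map (gap_number ?g) [1..<Suc M] @ [r]"
    unfolding map_Suc_upt by (simp add: v_def)
  have "(2::nat) ^ ?g i \<le> 2 ^ 3" for i by (intro power_increasing gap_le) simp
  then have "q i + d i \<le> 9" if "i < M" for i using that by (auto simp: q_def d_def)
  then have "(\<Sum>i<M. q i + d i) \<le> (\<Sum>i<M. 9)" by (intro sum_mono) auto
  moreover have "(\<Sum>i=M..<?n. q i + d i) \<le> (\<Sum>i=M..<?n. 3)"
    by (intro sum_mono) (auto simp: q_def d_def)
  moreover have "(\<Sum>i<?n. q i + d i) = (\<Sum>i<M. q i + d i) + (\<Sum>i=M..<?n. q i + d i)"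
    by (metis (no_types, lifting) atLeast0LessThan le_SucI le_add1 sum.atLeastLessThan_concat zero_le)
  ultimately have s: "(\<Sum>i<?n. q i + d i) \<le> 9 * M + 3 * Suc Q" by simp
  have "q 0 = 0" "?is \<noteq> []" "set ?is \<subseteq> {..<?n}" by (auto simp: q_def)
  then have "smallest_slp_size (unary_word (map v ?is)) \<le> (\<Sum>i<?n. q i + d i) + 2 * length ?is"
    by (intro smallest_slp_size_unary_word v qd)
  then show ?thesis unfolding w using s by simp
qed

lemma ex_gap_word:
  fixes sel :: "(nat, nat) grammar \<Rightarrow> (nat, nat) sym list"
  assumes sel: "selection_rule sel" and m: "m \<ge> 3" and M: "M = Suc m * 2 ^ m"
    and n: "2 ^ (4 * M) \<le> n" "n < 2 ^ N"
  shows "\<exists>w. set w \<subseteq> {1..2} \<and> length w = n \<and> w \<noteq> [] \<and>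
    M\<^sup>2 \<le> 8 * (2 * m + 3) * gsize (RePair sel w) \<and>
    smallest_slp_size w \<le> 11 * M + 3 * N + 5"
proof -
  \<comment> \<open>All gaps are at most 3, so \<open>3 * M\<close> rounds turn every gap number
    into its list of ones.\<close>
  let ?h = "gap_number (gap m)" and ?J = "3 * M"
  have "(2::nat) ^ 3 \<le> 2 ^ m" using m by (intro power_increasing) auto
  then have "1 * 2 ^ 3 \<le> M" unfolding M by (intro mult_le_mono) auto
  then have M8: "M \<ge> 8" by simp
  define S where "S = (\<Sum>i\<leftarrow>[1..<Suc M]. Suc (?h i))"
  have h: "Suc (?h i) \<le> 2 ^ ?J" if "i \<in> set [1..<Suc M]" for i
  proof -
    have "?h i < 2 ^ gap_sum (gap m) i" by (rule gap_number_less[OF gap_pos])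
    also have "(2::nat) ^ gap_sum (gap m) i \<le> 2 ^ ?J"
      using that gap_sum_le[of m i] by (intro power_increasing) auto
    finally show ?thesis by simp
  qed
  have "S \<le> (\<Sum>i\<leftarrow>[1..<Suc M]. 2 ^ ?J)" unfolding S_def by (rule sum_list_mono[OF h])
  then have S: "S \<le> M * 2 ^ ?J" by (simp add: sum_list_triv del: upt_Suc)
  \<comment> \<open>The room is split as \<open>(3 * M + 8) * 2 ^ ?J\<close> for the padding
    exponent, \<open>M * 2 ^ ?J\<close> for the first \<open>M\<close> blocks, and the rest for the
    last separator.\<close>
  have "(4 * M + 9) * 2 ^ ?J \<le> 2 ^ M * 2 ^ ?J"
    using four_mult_less_power2[of M] M8 by (intro mult_le_mono1) simp
  also have "\<dots> = 2 ^ (4 * M)" by (simp flip: power_add)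
  finally have n': "(4 * M + 9) * 2 ^ ?J \<le> n" using n(1) by linarith
  \<comment> \<open>The padding exponent is chosen to make the total length exactly
    \<open>n\<close>.\<close>
  define r where "r = n - Suc S"
  have "(4 * M + 9) * 2 ^ ?J = (3 * M + 8) * 2 ^ ?J + M * 2 ^ ?J + 2 ^ ?J" by (simp add: algebra_simps)
  moreover have "(1::nat) \<le> 2 ^ ?J" by simp
  ultimately have "(3 * M + 8) * 2 ^ ?J + S + 1 \<le> n" using S n' by linarith
  then have r: "(3 * M + 8) * 2 ^ ?J \<le> r" "n = S + Suc r" unfolding r_def by linarith+
  define ns where "ns = map ?h [1..<Suc M] @ [r]"
  have len: "length (unary_word ns) = n"
    using r(2) by (simp add: length_unary_word ns_def S_def o_def del: upt_Suc)
  have ns: "ns \<noteq> []" "length ns = Suc M" by (simp_all add: ns_def del: upt_Suc)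
  have big: "3 * length ns + 4 < (\<Sum>n\<leftarrow>ns. n div 2 ^ j)" if "j < ?J" for j
  proof -
    have "3 * M + 8 = (3 * M + 8) * 2 ^ ?J div 2 ^ ?J" by simp
    also have "\<dots> \<le> r div 2 ^ ?J" by (rule div_le_mono[OF r(1)])
    also have "\<dots> \<le> r div 2 ^ j" by (rule div_le_mono2) (use that in auto)
    also have "\<dots> \<le> (\<Sum>n\<leftarrow>ns. n div 2 ^ j)" by (rule sum_list_ge_div) (simp add: ns_def)
    finally show ?thesis using ns(2) by simp
  qed
  have "M\<^sup>2 \<le> 8 * card (factors (2 * m + 3) (halved ?J ns))"
  proof (rule card_factors_halved[OF m M])
    show "?h i \<in> set ns" if "i \<in> {1..M}" for i
      using that unfolding ns_def set_append set_map set_upt atLeastLessThanSuc_atLeastAtMost by blast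
  qed (rule gap_sum_le)
  moreover have "card (factors (2 * m + 3) (halved ?J ns)) \<le>
      (2 * m + 3) * gsize (RePair sel (unary_word ns))"
    by (rule factors_le_RePair[OF sel ns(1) _ big]) simp
  ultimately have R: "M\<^sup>2 \<le> 8 * (2 * m + 3) * gsize (RePair sel (unary_word ns))"
    unfolding mult.assoc by linarith
  have "0 < (3 * M + 8) * 2 ^ ?J" by simp
  then have "r \<ge> 1" using r(1) by linarith
  then obtain Q where Q: "2 ^ Q \<le> r" "r < 2 ^ Suc Q" using ex_power_ivl1[of 2 r] by auto
  have "(2::nat) ^ Q < 2 ^ N" using Q(1) r(2) n(2) by linarith
  then have "Q < N" by simp
  then have "smallest_slp_size (unary_word ns) \<le> 11 * M + 3 * N + 5"
    using smallest_slp_size_gap_word[OF Q, of M m] M8 unfolding ns_def by linarith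
  moreover have "unary_word ns \<noteq> []" using len n(1) M8
    by (metis length_0_conv not_one_le_zero one_le_power one_le_numeral order_trans)
  ultimately show ?thesis using R len set_unary_word[of ns] by (intro exI[of _ "unary_word ns"]) simp
qed

section \<open>From the special words to all large lengths\<close>

lemma approx_ratio_ge:
  assumes "set w \<subseteq> {1..k}" "length w = n"
  shows "real (gsize (C w)) / real (smallest_slp_size w) \<le> approx_ratio C k n"
proof -
  have "finite ((\<lambda>w. real (gsize (C w)) / real (smallest_slp_size w)) ` {w. set w \<subseteq> {1..k} \<and> length w = n})"
    by (intro finite_imageI finite_lists_length_eq) simp
  then have "finite {real (gsize (C w)) / real (smallest_slp_size w) | w. set w \<subseteq> {1..k} \<and> length w = n}"
    by (simp only: setcompr_eq_image)
  then show ?thesis unfolding approx_ratio_def by (rule Max_ge) (use assms in blast)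
qed

text \<open>Passing from \<open>m\<close> to \<open>Suc m\<close> multiplies
  \<open>Suc m * 2 ^ m\<close> by at most 4, so the largest \<open>m\<close> meeting the lower bound
  also meets the upper one.\<close>

lemma ex_scale:
  fixes n :: nat
  assumes "n \<ge> 2 ^ (4 * (Suc 3 * 2 ^ 3))"
  shows "\<exists>m\<ge>3. 2 ^ (4 * (Suc m * 2 ^ m)) \<le> n \<and> n < 2 ^ (16 * (Suc m * 2 ^ m))"
proof -
  let ?P = "\<lambda>m. (2::nat) ^ (4 * (Suc m * 2 ^ m)) \<le> n"
  have bound: "m \<le> n" if "?P m" for m
  proof -
    have "m * 1 \<le> (4 * Suc m) * 2 ^ m" by (intro mult_le_mono) auto
    then have "m \<le> 4 * (Suc m * 2 ^ m)" by (simp only: mult.assoc mult_1_right)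
    then have "m < 2 ^ (4 * (Suc m * 2 ^ m))" by (rule le_less_trans[OF _ less_exp])
    then show ?thesis using that by linarith
  qed
  define m where "m = Greatest ?P"
  have P: "?P m" unfolding m_def by (rule GreatestI_nat[of ?P 3 n, OF assms bound])
  have greatest: "k \<le> m" if "?P k" for k
    unfolding m_def by (rule Greatest_le_nat[of ?P k n, OF that bound])
  have "3 \<le> m" by (rule greatest[OF assms])
  moreover have "\<not> ?P (Suc m)" using greatest[of "Suc m"] by linarith
  moreover have "4 * (Suc (Suc m) * 2 ^ Suc m) \<le> 16 * (Suc m * 2 ^ m)" by simp
  then have "(2::nat) ^ (4 * (Suc (Suc m) * 2 ^ Suc m)) \<le> 2 ^ (16 * (Suc m * 2 ^ m))"
    by (rule power_increasing) simp
  ultimately show ?thesis using P by (intro exI[of _ m]) linarith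
qed

theorem theorem3p7:
  fixes sel :: "(nat, nat) grammar \<Rightarrow> (nat, nat) sym list"
  assumes "selection_rule sel"
  shows "(\<lambda>n. approx_ratio (RePair sel) 2 n) \<in> \<Omega>(\<lambda>n. ln (real n) / ln (ln (real n)))"
proof (rule landau_omega.bigI)
  let ?n0 = "2 ^ (4 * (Suc 3 * 2 ^ 3)) :: nat"
  \<comment> \<open>The constant is \<open>16 * 64 * 8 * 6\<close>, from
    \<open>ln n < 16 * M\<close>, from the SLP size at most \<open>64 * M\<close>, from the factor 8
    in \<open>ex_gap_word\<close>, and from \<open>2 * m + 3 <= 6 * ln (ln n)\<close>.\<close>
  show "(1 / 49152 :: real) > 0" by simp
  show "\<forall>\<^sub>F n in at_top. norm (approx_ratio (RePair sel) 2 n) \<ge>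
      1 / 49152 * norm (ln (real n) / ln (ln (real n)))"
    using eventually_ge_at_top[of ?n0]
  proof (rule eventually_mono)
    fix n assume "?n0 \<le> n"
    then obtain m where m: "m \<ge> 3" "2 ^ (4 * (Suc m * 2 ^ m)) \<le> n" "n < 2 ^ (16 * (Suc m * 2 ^ m))"
      using ex_scale by blast
    define M where "M = Suc m * 2 ^ m"
    define x where "x = ln (real n)"
    note mM = m(2,3)[folded M_def]
    obtain w where w: "set w \<subseteq> {1..2}" "length w = n" "w \<noteq> []"
      "M\<^sup>2 \<le> 8 * (2 * m + 3) * gsize (RePair sel w)"
      "smallest_slp_size w \<le> 11 * M + 3 * (16 * M) + 5"
      using ex_gap_word[OF assms m(1) M_def mM] by blast
    let ?R = "real (gsize (RePair sel w))" and ?s = "real (smallest_slp_size w)"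
    have "4 * 1 \<le> Suc m * 2 ^ m" by (intro mult_le_mono) (use m(1) in \<open>simp_all\<close>)
    then have M4: "M \<ge> 4" by (simp add: M_def)
    have s: "?s \<le> 64 * real M" using w(5) M4 by linarith
    have s0: "?s > 0" using smallest_slp_size_pos[OF w(3)] by simp
    have n0: "real n > 0" using mM(1) by (metis less_le_trans of_nat_0_less_iff pos2 zero_less_power)
    have ln2: "1 / 2 \<le> ln (2::real)" "ln (2::real) \<le> 1"
      using ln_le_minus_one[of "1 / 2"] ln_le_minus_one[of 2] by (simp_all add: ln_div)
    have "(2::real) ^ (4 * M) \<le> real n"
      using mM(1) by (metis of_nat_le_iff of_nat_numeral of_nat_power)
    then have "ln (2 ^ (4 * M)) \<le> x" unfolding x_def using n0 by (subst ln_le_cancel_iff) simp_all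
    then have "real (4 * M) * ln 2 \<le> x" by (simp add: ln_realpow)
    moreover have "real (4 * M) * (1 / 2) \<le> real (4 * M) * ln 2" by (intro mult_left_mono ln2) simp
    ultimately have xM: "2 * real M \<le> x" by simp
    have "real n < 2 ^ (16 * M)"
      using mM(2) by (metis of_nat_less_iff of_nat_numeral of_nat_power)
    then have "x < ln (2 ^ (16 * M))" unfolding x_def using n0 by (subst ln_less_cancel_iff) simp_all
    then have "x < real (16 * M) * ln 2" by (simp add: ln_realpow)
    also have "\<dots> \<le> real (16 * M) * 1" by (intro mult_left_mono ln2) simp
    finally have Mx: "x < 16 * real M" by simp
    \<comment> \<open>This turns the factor length \<open>2 * m + 3\<close> into
      \<open>O(ln (ln n))\<close>, the denominator of the claim.\<close>
    have "2 ^ Suc m \<le> 2 * M" by (simp add: M_def)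
    then have "(2::real) ^ Suc m \<le> real (2 * M)"
      by (metis of_nat_le_iff of_nat_numeral of_nat_power)
    also have "\<dots> \<le> x" using xM by simp
    finally have "2 ^ Suc m \<le> x" .
    then have "ln (2 ^ Suc m) \<le> ln x" by (subst ln_le_cancel_iff) (auto intro: less_le_trans[of 0 "2 ^ Suc m"])
    then have "real (Suc m) * ln 2 \<le> ln x" by (simp only: ln_realpow)
    moreover have "real (Suc m) * (1 / 2) \<le> real (Suc m) * ln 2" by (intro mult_left_mono ln2) simp
    ultimately have "real (Suc m) * (1 / 2) \<le> ln x" by linarith
    then have lx: "real (2 * m + 3) \<le> 6 * ln x" by simp
    have m0: "real (2 * m + 3) > 0" by simp
    have "real (M\<^sup>2) \<le> real (8 * (2 * m + 3) * gsize (RePair sel w))" using w(4) by (simp only: of_nat_le_iff)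
    also have "\<dots> = 8 * real (2 * m + 3) * ?R" by simp
    finally have MR: "(real M)\<^sup>2 \<le> 8 * real (2 * m + 3) * ?R" by simp
    have "x * ?s \<le> 16 * real M * (64 * real M)"
      using Mx s s0 by (intro mult_mono) auto
    also have "\<dots> = 1024 * (real M)\<^sup>2" by (simp add: power2_eq_square)
    also have "\<dots> \<le> 1024 * (8 * real (2 * m + 3) * ?R)" using MR by simp
    also have "\<dots> \<le> 1024 * (8 * (6 * ln x) * ?R)"
      using lx by (intro mult_left_mono mult_right_mono) auto
    finally have "x * ?s \<le> 49152 * (ln x * ?R)" by (simp add: mult_ac)
    moreover have lx0: "ln x > 0" using lx m0 by linarith
    ultimately have "1 / 49152 * (x / ln x) \<le> ?R / ?s" using s0 by (simp add: field_simps)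
    also have "\<dots> \<le> approx_ratio (RePair sel) 2 n" by (rule approx_ratio_ge[OF w(1,2)])
    finally have le: "1 / 49152 * (x / ln x) \<le> approx_ratio (RePair sel) 2 n" .
    have "x / ln x \<ge> 0" using lx0 xM by simp
    then show "norm (approx_ratio (RePair sel) 2 n) \<ge> 1 / 49152 * norm (ln (real n) / ln (ln (real n)))"
      using le unfolding x_def by simp
  qed
qed

end
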